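(* Under full information feedback, when $v_1,\dots,v_T$ are sampled i.i.d. from some distribution $F$ on $[0,\bar v]$, there is a constant $C$ such that with probability at least $1-4/T$, the OGD-CB algorithm $\beta$ guarantees \[\mathrm{OPT}-R^\beta(\bm v,\bm p)\le C\sqrt{T\ln T}.\]
   Context: Model: constants $\bar v>0$, $\rho\in(0,\bar v]$; $T$ rounds; budget $B=\rho T$. In round $t$ the buyer has value $v_t\in[0,\bar v]$; highest competing bid $p_t$ i.i.d. from an unknown distribution $G$ on $[0,\bar v]$, independent of the values. Buyer chooses $x_t\in\{0,1\}$, receives $x_tr_t$ with $r_t=(v_t-p_t)^+$ and pays $x_tc_t$ with $c_t=p_t\mathbf 1[v_t\ge p_t]$. Full information feedback: $p_t$ is observed at the end of every round; partial information feedback: $p_t$ is observed only if $x_t=1$. Revenue $R^\beta(\bm v,\bm p)=\sum_{t=1}^{T_0}x_tr_t$, $T_0$ the ending time. Fluid benchmark: $\mathrm{OPT}=T\max_{\pi:[0,\bar v]\to[0,1]}\mathbb E_{v\sim F,p\sim G}[\pi(v)(v-p)^+]$ s.t. $\mathbb E_{v\sim F,p\sim G}[\pi(v)p\mathbf 1[v\ge p]]\le\rho$. OGD-CB algorithm: initialize $\mathcal I_1=\emptyset$, $B_1=B$, $\lambda_1=0$. For $t=1,\dots,T$: observe $v_t$. If $t=1$: $x_1=1$, $\lambda_2=\lambda_1$. Otherwise: $\epsilon_t=\sqrt{(\ln 2+2\ln T)/(2|\mathcal I_t|)}$; $\tilde r_t(v)=\frac1{|\mathcal I_t|}\sum_{\tau\in\mathcal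 I_t}(v-p_\tau)^++\epsilon_tv$; $\tilde c_t(v)=\frac1{|\mathcal I_t|}\sum_{\tau\in\mathcal I_t}p_\tau\mathbf 1[v\ge p_\tau]-2\epsilon_tv$; $x_t=\mathbf 1[\tilde r_t(v_t)\ge\lambda_t\tilde c_t(v_t)]$; $\eta_t=1/(\bar v\sqrt t)$; $\lambda_{t+1}=(\lambda_t+\eta_t(x_t\tilde c_t(v_t)-\rho))^+$. Then if (full information) or (partial information and $x_t=1$), observe $p_t$ and set $\mathcal I_{t+1}=\mathcal I_t\cup\{t\}$, else $\mathcal I_{t+1}=\mathcal I_t$. Set $B_{t+1}=B_t-x_tc_t$; if $B_{t+1}<\bar v$, stop. $T_0$ is the round at which the algorithm stops (or $T$). *)

theory Defs
  imports "HOL-Probability.Probability"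
begin

definition rew :: "real \<Rightarrow> real \<Rightarrow> real" where
  "rew v p = max 0 (v - p)"

definition cst :: "real \<Rightarrow> real \<Rightarrow> real" where
  "cst v p = (if v \<ge> p then p else 0)"

definition ocb_eps :: "nat \<Rightarrow> nat set \<Rightarrow> real" where
  "ocb_eps T I = sqrt ((ln 2 + 2 * ln (real T)) / (2 * real (card I)))"

definition tilde_r :: "nat \<Rightarrow> (nat \<Rightarrow> real) \<Rightarrow> nat set \<Rightarrow> real \<Rightarrow> real" where
  "tilde_r T p I v = (\<Sum>\<tau>\<in>I. rew v (p \<tau>)) / real (card I) + ocb_eps T I * v"

definition tilde_c :: "nat \<Rightarrow> (nat \<Rightarrow> real) \<Rightarrow> nat set \<Rightarrow> real \<Rightarrow> real" where
  "tilde_c T p I v = (\<Sum>\<tau>\<in>I. cst v (p \<tau>)) / real (card I) - 2 * ocb_eps T I * v"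

definition ogd_x :: "nat \<Rightarrow> (nat \<Rightarrow> real) \<Rightarrow> real \<Rightarrow> nat set \<Rightarrow> nat \<Rightarrow> real \<Rightarrow> real" where
  "ogd_x T p lam I t vt =
     (if t = 1 then 1 else if tilde_r T p I vt \<ge> lam * tilde_c T p I vt then 1 else 0)"

text \<open>State of OGD-CB before round n+1: (lambda, remaining budget B, observed set I,
  still running). The flag full selects full (True) or partial (False) feedback.\<close>
primrec ogd_state :: "bool \<Rightarrow> real \<Rightarrow> real \<Rightarrow> nat \<Rightarrow> (nat \<Rightarrow> real) \<Rightarrow> (nat \<Rightarrow> real)
    \<Rightarrow> nat \<Rightarrow> real \<times> real \<times> nat set \<times> bool" where
  "ogd_state full vbar rho T v p 0 = (0, rho * real T, {}, True)"
| "ogd_state full vbar rho T v p (Suc n) =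
     (case ogd_state full vbar rho T v p n of (lam, B, I, act) \<Rightarrow>
       (if \<not> act then (lam, B, I, False) else
        (let t = Suc n;
             x = ogd_x T p lam I t (v t);
             lam' = (if t = 1 then lam
                     else max 0 (lam + (1 / (vbar * sqrt (real t))) * (x * tilde_c T p I (v t) - rho)));
             I' = (if full \<or> x = 1 then insert t I else I);
             B' = B - x * cst (v t) (p t)
         in (lam', B', I', \<not> (B' < vbar)))))"

text \<open>Revenue R = sum over rounds t = 1..T_0 of x_t r_t: round t counts iff the
  algorithm has not stopped before round t.\<close>
definition ogd_revenue :: "bool \<Rightarrow> real \<Rightarrow> real \<Rightarrow> nat \<Rightarrow> (nat \<Rightarrow> real) \<Rightarrow> (nat \<Rightarrow> real) \<Rightarrow> real" where
  "ogd_revenue full vbar rho T v p =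
     (\<Sum>t = 1..T. (case ogd_state full vbar rho T v p (t - 1) of (lam, B, I, act) \<Rightarrow>
        (if act then ogd_x T p lam I t (v t) * rew (v t) (p t) else 0)))"

definition fluid_opt :: "real measure \<Rightarrow> real measure \<Rightarrow> real \<Rightarrow> nat \<Rightarrow> real" where
  "fluid_opt F G rho T = real T * Sup
     {(\<integral>vp. \<pi> (fst vp) * rew (fst vp) (snd vp) \<partial>(F \<Otimes>\<^sub>M G)) | \<pi>.
        \<pi> \<in> borel_measurable borel \<and> (\<forall>x. 0 \<le> \<pi> x \<and> \<pi> x \<le> 1) \<and>
        (\<integral>vp. \<pi> (fst vp) * cst (fst vp) (snd vp) \<partial>(F \<Otimes>\<^sub>M G)) \<le> rho}"

end

theory Submission
  imports Defs
begin

text \<open>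
  Write \<open>r(v)\<close> and \<open>c(v)\<close> for the expected reward and cost of value \<open>v\<close>, and fix a policy \<open>\<pi>\<close> that is
  optimal for the fluid problem up to \<open>1/T\<close>. Conditionally on \<open>v\<^sub>t\<close>, Hoeffding's inequality shows that the
  optimistic estimates satisfy \<open>r \<le> r~ \<le> r + 2 \<epsilon> v\<close> and \<open>c - 3 \<epsilon> v \<le> c~ \<le> c\<close>, so the greedy choice gives
  in each round \<open>x r \<ge> \<pi> r + \<lambda> (\<rho> - \<pi> c) + \<lambda> (x c~ - \<rho>) - 2 \<epsilon> v\<close>. The last but one term is the loss of
  projected gradient descent; comparing with the multiplier \<open>0\<close> if the algorithm never stops, and with
  \<open>vbar / \<rho>\<close> if the budget runs out, its sum pays for the rounds lost after stopping. This needs bounded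
  multipliers: \<open>\<lambda>\<close> can only grow while \<open>c~ > \<rho>\<close>, which forces \<open>\<epsilon> < 1/2\<close> and \<open>\<lambda> c~ \<le> r~ \<le> 3 vbar / 2\<close>.
  The remaining fluctuations are two martingales, controlled by the Azuma-Hoeffding inequality.
\<close>

section \<open>The Azuma-Hoeffding inequality on finite product spaces\<close>

text \<open>Induction on the number of coordinates: integrating out the last one first leaves, for a
  fixed history, a centred difference in \<open>[-K, K]\<close>, to which Hoeffding's lemma applies.
  Each \<open>D t\<close> is one function on infinite sequences, so adaptedness is invariance under
  changing a later coordinate. Boundedness and centring are asked only on histories in
  \<open>S\<close>, which are almost all.\<close>

lemma azuma_mgf:
  fixes M :: "'a measure" and D :: "nat \<Rightarrow> (nat \<Rightarrow> 'a) \<Rightarrow> real"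
  assumes M: "prob_space M"
    and meas [measurable]: "\<And>t n. t \<in> {1..n} \<Longrightarrow> n \<le> N \<Longrightarrow> D t \<in> borel_measurable (PiM {1..n} (\<lambda>_. M))"
    and adapted: "\<And>t n x y. t \<le> n \<Longrightarrow> D t (x(Suc n := y)) = D t x"
    and S: "AE y in M. y \<in> S"
    and bound: "\<And>n x y. n < N \<Longrightarrow> (\<forall>i\<in>{1..n}. x i \<in> S) \<Longrightarrow> y \<in> S \<Longrightarrow> \<bar>D (Suc n) (x(Suc n := y))\<bar> \<le> K"
    and mean: "\<And>n x. n < N \<Longrightarrow> x \<in> space (PiM {1..n} (\<lambda>_. M)) \<Longrightarrow> (\<forall>i\<in>{1..n}. x i \<in> S) \<Longrightarrow>
                 (\<integral>y. D (Suc n) (x(Suc n := y)) \<partial>M) = 0"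
    and s: "s > 0"
  shows "n \<le> N \<Longrightarrow> (\<integral>\<^sup>+x. ennreal (exp (s * (\<Sum>t=1..n. D t x))) \<partial>PiM {1..n} (\<lambda>_. M))
           \<le> ennreal (exp (n * (s\<^sup>2 * K\<^sup>2 / 2)))"
proof (induction n)
  case 0
  interpret P: prob_space "PiM {} (\<lambda>_::nat. M)" by (intro prob_space_PiM M)
  show ?case using P.emeasure_space_1 by simp
next
  case (Suc n)
  interpret prob_space M by (rule M)
  interpret ps: product_sigma_finite "\<lambda>_::nat. M" by standard
  let ?P = "PiM {1..n} (\<lambda>_. M)"
  let ?E = "\<lambda>n x. ennreal (exp (s * (\<Sum>t=1..n. D t x)))"
  have ins: "{1..Suc n} = insert (Suc n) {1..n}" by auto
  have [measurable]: "(\<lambda>x. \<Sum>t=1..m. D t x) \<in> borel_measurable (PiM {1..m} (\<lambda>_. M))" if "m \<le> N" for m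
    using that by (intro borel_measurable_sum meas) auto
  have mE: "?E (Suc n) \<in> borel_measurable (PiM (insert (Suc n) {1..n}) (\<lambda>_. M))"
    unfolding ins[symmetric] using Suc.prems by measurable
  have "(\<integral>\<^sup>+x. ?E (Suc n) x \<partial>PiM {1..Suc n} (\<lambda>_. M))
      = (\<integral>\<^sup>+x. ?E (Suc n) x \<partial>PiM (insert (Suc n) {1..n}) (\<lambda>_. M))"
    by (simp only: ins)
  also have "\<dots> = (\<integral>\<^sup>+x. (\<integral>\<^sup>+y. ?E (Suc n) (x(Suc n := y)) \<partial>M) \<partial>?P)"
    by (rule ps.product_nn_integral_insert[OF _ _ mE]) auto
  also have "\<dots> \<le> (\<integral>\<^sup>+x. ?E n x * ennreal (exp (s\<^sup>2 * K\<^sup>2 / 2)) \<partial>?P)"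
  proof (rule nn_integral_mono_AE)
    have "AE x in ?P. \<forall>i\<in>{1..n}. x i \<in> S"
      by (intro AE_finite_allI AE_PiM_component M S) auto
    then show "AE x in ?P. (\<integral>\<^sup>+y. ?E (Suc n) (x(Suc n := y)) \<partial>M) \<le> ?E n x * ennreal (exp (s\<^sup>2 * K\<^sup>2 / 2))"
    proof (rule AE_mp, intro AE_I2 impI)
      fix x assume x: "x \<in> space ?P" and xS: "\<forall>i\<in>{1..n}. x i \<in> S"
      have *: "(\<lambda>y. x(Suc n := y)) \<in> M \<rightarrow>\<^sub>M PiM {1..Suc n} (\<lambda>_. M)"
        unfolding ins by (rule measurable_fun_upd[where J="{1..n}"]) (use x in auto)
      have m [measurable]: "(\<lambda>y. D (Suc n) (x(Suc n := y))) \<in> borel_measurable M"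
        by (rule measurable_compose[OF * meas]) (use Suc.prems in auto)
      have "AE y in M. D (Suc n) (x(Suc n := y)) \<in> {-K..K}"
        using S
      proof eventually_elim
        case (elim y)
        then show ?case using bound[of n x y] xS Suc.prems by (simp add: abs_le_iff)
      qed
      then interpret h: interval_bounded_random_variable M "\<lambda>y. D (Suc n) (x(Suc n := y))" "-K" K
        by unfold_locales (use m in auto)
      \<comment> \<open>By adaptedness the first \<open>n\<close> differences do not see
        \<open>y\<close>, so their exponential is a constant factor.\<close>
      have "(\<integral>\<^sup>+y. ?E (Suc n) (x(Suc n := y)) \<partial>M)
          = (\<integral>\<^sup>+y. ?E n x * ennreal (exp (s * D (Suc n) (x(Suc n := y)))) \<partial>M)"
        by (intro nn_integral_cong) (simp add: adapted distrib_left exp_add ennreal_mult)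
      also have "\<dots> = ?E n x * (\<integral>\<^sup>+y. ennreal (exp (s * D (Suc n) (x(Suc n := y)))) \<partial>M)"
        by (intro nn_integral_cmult) measurable
      also have "\<dots> \<le> ?E n x * ennreal (exp (s\<^sup>2 * (K - (-K))\<^sup>2 / 8))"
        by (intro mult_left_mono h.Hoeffdings_lemma_nn_integral_0 s mean x xS) (use Suc.prems in auto)
      \<comment> \<open>The interval has length \<open>2 * K\<close>.\<close>
      also have "s\<^sup>2 * (K - (-K))\<^sup>2 / 8 = s\<^sup>2 * K\<^sup>2 / 2"
        by (simp add: power2_eq_square)
      finally show "(\<integral>\<^sup>+y. ?E (Suc n) (x(Suc n := y)) \<partial>M) \<le> ?E n x * ennreal (exp (s\<^sup>2 * K\<^sup>2 / 2))" .
    qed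
  qed
  also have "\<dots> = (\<integral>\<^sup>+x. ?E n x \<partial>?P) * ennreal (exp (s\<^sup>2 * K\<^sup>2 / 2))"
    by (intro nn_integral_multc measurable_compose[OF _ measurable_ennreal] measurable_compose[OF _ borel_measurable_exp]
        borel_measurable_times borel_measurable_const borel_measurable_sum meas) (use Suc.prems in auto)
  also have "\<dots> \<le> ennreal (exp (n * (s\<^sup>2 * K\<^sup>2 / 2))) * ennreal (exp (s\<^sup>2 * K\<^sup>2 / 2))"
    using Suc by (intro mult_right_mono) auto
  also have "\<dots> = ennreal (exp (Suc n * (s\<^sup>2 * K\<^sup>2 / 2)))"
    by (simp add: exp_add[symmetric] ennreal_mult[symmetric] distrib_right)
  finally show ?case .
qed

lemma azuma:
  fixes M :: "'a measure" and D :: "nat \<Rightarrow> (nat \<Rightarrow> 'a) \<Rightarrow> real"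
  assumes M: "prob_space M"
    and meas [measurable]: "\<And>t n. t \<in> {1..n} \<Longrightarrow> n \<le> N \<Longrightarrow> D t \<in> borel_measurable (PiM {1..n} (\<lambda>_. M))"
    and adapted: "\<And>t n x y. t \<le> n \<Longrightarrow> D t (x(Suc n := y)) = D t x"
    and S: "AE y in M. y \<in> S"
    and bound: "\<And>n x y. n < N \<Longrightarrow> (\<forall>i\<in>{1..n}. x i \<in> S) \<Longrightarrow> y \<in> S \<Longrightarrow> \<bar>D (Suc n) (x(Suc n := y))\<bar> \<le> K"
    and mean: "\<And>n x. n < N \<Longrightarrow> x \<in> space (PiM {1..n} (\<lambda>_. M)) \<Longrightarrow> (\<forall>i\<in>{1..n}. x i \<in> S) \<Longrightarrow>
                 (\<integral>y. D (Suc n) (x(Suc n := y)) \<partial>M) = 0"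
    and "K > 0" "N > 0" "z > 0"
  shows "measure (PiM {1..N} (\<lambda>_. M)) {x\<in>space (PiM {1..N} (\<lambda>_. M)). (\<Sum>t=1..N. D t x) \<ge> z}
           \<le> exp (- z\<^sup>2 / (2 * N * K\<^sup>2))"
proof -
  let ?P = "PiM {1..N} (\<lambda>_. M)"
  interpret P: prob_space ?P by (intro prob_space_PiM M)
  \<comment> \<open>The minimiser of the Chernoff exponent
    \<open>- s * z + N * s^2 * K^2 / 2\<close>.\<close>
  define s where "s = z / (N * K\<^sup>2)"
  have s: "s > 0" using assms by (simp add: s_def)
  have [measurable]: "(\<lambda>x. \<Sum>t=1..N. D t x) \<in> borel_measurable ?P"
    by (intro borel_measurable_sum meas) auto
  have "emeasure ?P {x\<in>space ?P. (\<Sum>t=1..N. D t x) \<ge> z}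
      \<le> ennreal (exp (-s * z)) * (\<integral>\<^sup>+x. ennreal (exp (s * (\<Sum>t=1..N. D t x))) * indicator (space ?P) x \<partial>?P)"
    by (intro Chernoff_ineq_nn_integral_ge s) measurable
  also have "(\<integral>\<^sup>+x. ennreal (exp (s * (\<Sum>t=1..N. D t x))) * indicator (space ?P) x \<partial>?P)
      = (\<integral>\<^sup>+x. ennreal (exp (s * (\<Sum>t=1..N. D t x))) \<partial>?P)"
    by (intro nn_integral_cong) auto
  also have "\<dots> \<le> ennreal (exp (N * (s\<^sup>2 * K\<^sup>2 / 2)))"
    by (rule azuma_mgf[OF M meas adapted S bound mean s order_refl])
  finally have "ennreal (P.prob {x\<in>space ?P. (\<Sum>t=1..N. D t x) \<ge> z})
      \<le> ennreal (exp (-s * z + N * (s\<^sup>2 * K\<^sup>2 / 2)))"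
    by (simp add: P.emeasure_eq_measure ennreal_mult[symmetric] exp_add[symmetric] mult_left_mono
        del: One_nat_def)
  also have "-s * z + N * (s\<^sup>2 * K\<^sup>2 / 2) = - z\<^sup>2 / (2 * N * K\<^sup>2)"
    using assms by (simp add: s_def field_simps power2_eq_square)
  finally show ?thesis by (subst (asm) ennreal_le_iff) auto
qed

text \<open>The joint law of the coordinates in \<open>I\<close> is the product of their marginals,
  because restricting a finite product measure gives the smaller product.\<close>

lemma indep_vars_PiM_coordinates:
  fixes M :: "'a measure"
  assumes M: "prob_space M" and "finite J" "I \<subseteq> J" "I \<noteq> {}"
  shows "prob_space.indep_vars (PiM J (\<lambda>_. M)) (\<lambda>_. M) (\<lambda>i x. x i) I"
proof -
  interpret P: prob_space "PiM J (\<lambda>_. M)" by (intro prob_space_PiM M)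
  interpret product_prob_space "\<lambda>_. M" J
    by (simp add: product_prob_space_def product_prob_space_axioms_def product_sigma_finite_def M
        prob_space_imp_sigma_finite)
  have I: "finite I" using assms finite_subset by auto
  show ?thesis
  proof (subst P.indep_vars_iff_distr_eq_PiM')
    show "distr (PiM J (\<lambda>_. M)) (PiM I (\<lambda>_. M)) (\<lambda>x. \<lambda>i\<in>I. x i)
        = (\<Pi>\<^sub>M i\<in>I. distr (PiM J (\<lambda>_. M)) M (\<lambda>x. x i))"
      using distr_PiM_restrict_finite[OF I \<open>I \<subseteq> J\<close>] \<open>I \<subseteq> J\<close>
      by (simp add: PiM_component subsetD cong: PiM_cong)
  qed (use assms in auto)
qed

section \<open>Projected gradient descent and the pathwise regret bound\<close>

text \<open>The arithmetic-geometric mean inequality bounds each term by the telescoping difference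
  \<open>2 * sqrt (N + 1) - 2 * sqrt N\<close>.\<close>

lemma sum_inverse_sqrt: "(\<Sum>n=1..N. 1 / sqrt (real n)) \<le> 2 * sqrt (real N)"
proof (induction N)
  case (Suc N)
  have "2 * sqrt (real N) * sqrt (real (Suc N)) \<le> (sqrt (real N))\<^sup>2 + (sqrt (real (Suc N)))\<^sup>2"
    by (rule sum_squares_bound)
  then have "1 / sqrt (real (Suc N)) \<le> 2 * sqrt (real (Suc N)) - 2 * sqrt (real N)"
    by (simp add: field_simps)
  with Suc show ?case by simp
qed simp

text \<open>The subtracted \<open>2 / sqrt N\<close> makes the induction telescope; the base case is
  the equality \<open>1 = 3 - 2\<close>.\<close>

lemma sum_inverse_mult_sqrt:
  assumes "N \<ge> 1"
  shows "(\<Sum>n=1..N. 1 / (real n * sqrt (real n))) \<le> 3 - 2 / sqrt (real N)"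
  using assms
proof (induction N rule: dec_induct)
  case (step N)
  define a b where "a = sqrt (real N)" and "b = sqrt (real (Suc N))"
  have ab: "0 < a" "a \<le> b" "b\<^sup>2 = a\<^sup>2 + 1" "real N = a\<^sup>2" "real (Suc N) = b\<^sup>2"
    using step by (auto simp: a_def b_def)
  have "a * (a + b) \<le> b * (b + b)"
    using ab by (intro mult_mono) auto
  then have "a * (a + b) * b \<le> 2 * b * b * b"
    using ab mult_right_mono[of "a * (a + b)" "b * (b + b)" b] by (simp add: algebra_simps)
  then have "1 / (2 * b * b * b) \<le> 1 / (a * (a + b) * b)"
    using ab by (intro frac_le) auto
  then have "1 / (b\<^sup>2 * b) \<le> 2 * (1 / (a * (a + b) * b))"
    by (simp add: power2_eq_square mult.assoc)
  \<comment> \<open>Since \<open>b^2 = a^2 + 1\<close>, the difference \<open>b - a\<close> is the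
    reciprocal of \<open>a + b\<close>.\<close>
  also have "1 / (a * (a + b) * b) = (b - a) / (a * b)"
  proof -
    have "(b - a) * (a + b) = 1" using ab(3) by (simp add: power2_eq_square algebra_simps)
    then have "1 / (a * (a + b) * b) = ((b - a) * (a + b)) / ((a * b) * (a + b))"
      by (simp add: mult_ac)
    also have "\<dots> = (b - a) / (a * b)"
      using ab by simp
    finally show ?thesis .
  qed
  also have "2 * \<dots> = 2 / a - 2 / b"
    using ab by (simp add: field_simps)
  finally have "1 / (real (Suc N) * sqrt (real (Suc N))) \<le> 2 / sqrt (real N) - 2 / sqrt (real (Suc N))"
    unfolding ab(5)[symmetric] unfolding a_def b_def .
  with step show ?case by simp
qed simp

lemma ocb_eps_nonneg: "0 \<le> ocb_eps T I"
  by (cases "T = 0") (auto simp: ocb_eps_def)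

text \<open>The potential is the squared distance of the iterate to the comparator
  \<open>mu\<close>. Sums start at 2 because OGD-CB leaves the multiplier unchanged in round
  1.\<close>

lemma projected_ogd_regret:
  fixes lam g eta :: "nat \<Rightarrow> real"
  assumes upd: "\<And>t. 2 \<le> t \<Longrightarrow> t \<le> N \<Longrightarrow> lam (Suc t) = max 0 (lam t + eta t * g t)"
    and eta: "\<And>t. eta t > 0" "\<And>t. 2 \<le> t \<Longrightarrow> eta (Suc t) \<le> eta t"
    and lam: "\<And>t. t \<le> Suc N \<Longrightarrow> 0 \<le> lam t \<and> lam t \<le> L"
    and mu: "0 \<le> mu" "mu \<le> L"
    and N: "2 \<le> N"
  shows "(\<Sum>t=2..N. g t * (mu - lam t)) \<le> L\<^sup>2 / (2 * eta N) + (\<Sum>t=2..N. eta t * (g t)\<^sup>2) / 2"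
proof -
  have D: "(lam t - mu)\<^sup>2 \<le> L\<^sup>2" if "t \<le> Suc N" for t
    using lam[OF that] mu by (intro abs_le_square_iff[THEN iffD1]) auto
  have ogd_step: "g t * (mu - lam t) \<le> ((lam t - mu)\<^sup>2 - (lam (Suc t) - mu)\<^sup>2) / (2 * eta t) + eta t * (g t)\<^sup>2 / 2"
    if t: "2 \<le> t" "t \<le> N" for t
  proof -
    \<comment> \<open>Projection onto the nonnegative half-line does not increase the distance to a
      point \<open>mu\<close> in it.\<close>
    have "(lam (Suc t) - mu)\<^sup>2 \<le> (lam t + eta t * g t - mu)\<^sup>2"
      unfolding upd[OF t] using mu by (intro abs_le_square_iff[THEN iffD1]) (auto simp: max_def)
    also have "\<dots> = (lam t - mu)\<^sup>2 - 2 * eta t * (g t * (mu - lam t)) + (eta t)\<^sup>2 * (g t)\<^sup>2"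
      by (simp add: power2_eq_square algebra_simps)
    finally have "2 * eta t * (g t * (mu - lam t)) \<le> (lam t - mu)\<^sup>2 - (lam (Suc t) - mu)\<^sup>2 + (eta t)\<^sup>2 * (g t)\<^sup>2"
      by simp
    then have "g t * (mu - lam t) \<le> ((lam t - mu)\<^sup>2 - (lam (Suc t) - mu)\<^sup>2 + (eta t)\<^sup>2 * (g t)\<^sup>2) / (2 * eta t)"
      using eta(1)[of t] by (simp add: pos_le_divide_eq mult.commute)
    also have "\<dots> = ((lam t - mu)\<^sup>2 - (lam (Suc t) - mu)\<^sup>2) / (2 * eta t) + eta t * (g t)\<^sup>2 / 2"
      using eta(1)[of t] by (simp add: add_divide_distrib power2_eq_square)
    finally show ?thesis .
  qed
  \<comment> \<open>The remaining potential is kept on the left: when the step size shrinks, its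
    weight grows, and the growth is charged to \<open>L^2\<close>.\<close>
  have ind: "n \<le> N \<Longrightarrow> (\<Sum>t=2..n. g t * (mu - lam t)) + (lam (Suc n) - mu)\<^sup>2 / (2 * eta n)
      \<le> L\<^sup>2 / (2 * eta n) + (\<Sum>t=2..n. eta t * (g t)\<^sup>2) / 2" if "2 \<le> n" for n
    using that
  proof (induction n rule: dec_induct)
    case base
    have "(lam 2 - mu)\<^sup>2 / (2 * eta 2) \<le> L\<^sup>2 / (2 * eta 2)"
      using D[of 2] N eta(1)[of 2] by (intro divide_right_mono) auto
    with ogd_step[of 2] N show ?case by (simp add: diff_divide_distrib)
  next
    case (step n)
    have "(lam (Suc n) - mu)\<^sup>2 * (1 / (2 * eta (Suc n)) - 1 / (2 * eta n))
        \<le> L\<^sup>2 * (1 / (2 * eta (Suc n)) - 1 / (2 * eta n))"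
    proof (rule mult_right_mono)
      show "(lam (Suc n) - mu)\<^sup>2 \<le> L\<^sup>2" using D[of "Suc n"] step by simp
      show "0 \<le> 1 / (2 * eta (Suc n)) - 1 / (2 * eta n)"
        using eta(2)[of n] eta(1)[of "Suc n"] step by (simp add: frac_le)
    qed
    then have 1: "(lam (Suc n) - mu)\<^sup>2 / (2 * eta (Suc n)) - (lam (Suc n) - mu)\<^sup>2 / (2 * eta n)
        \<le> L\<^sup>2 / (2 * eta (Suc n)) - L\<^sup>2 / (2 * eta n)"
      by (simp only: right_diff_distrib times_divide_eq_right mult_1_right)
    have 2: "g (Suc n) * (mu - lam (Suc n)) \<le> (lam (Suc n) - mu)\<^sup>2 / (2 * eta (Suc n))
        - (lam (Suc (Suc n)) - mu)\<^sup>2 / (2 * eta (Suc n)) + eta (Suc n) * (g (Suc n))\<^sup>2 / 2"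
      using ogd_step[of "Suc n"] step.prems step.hyps by (simp only: diff_divide_distrib)
    have sums: "(\<Sum>t=2..Suc n. f t) = (\<Sum>t=2..n. f t) + f (Suc n)" for f :: "nat \<Rightarrow> real"
      using step.hyps by simp
    show ?case
      using step.IH step.prems 1 2 unfolding sums add_divide_distrib by linarith
  qed
  note ind[OF N order_refl]
  moreover have "0 \<le> (lam (Suc N) - mu)\<^sup>2 / (2 * eta N)"
    using eta(1)[of N] by simp
  ultimately show ?thesis by linarith
qed

lemma ogd_x_cong:
  assumes "\<And>i. i \<in> I \<Longrightarrow> p i = p' i"
  shows "ogd_x T p l I t u = ogd_x T p' l I t u"
proof -
  have "(\<Sum>i\<in>I. f u (p i)) = (\<Sum>i\<in>I. f u (p' i))" for f :: "real \<Rightarrow> real \<Rightarrow> real"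
    using assms by (intro sum.cong) auto
  then show ?thesis by (simp add: ogd_x_def tilde_r_def tilde_c_def)
qed

section \<open>State, decisions and multipliers under full feedback\<close>

locale ogd_full =
  fixes vbar rho :: real and T :: nat
  assumes vbar: "0 < vbar" and rho: "0 < rho" "rho \<le> vbar"
begin

abbreviation "st \<equiv> ogd_state True vbar rho T"

text \<open>
  The state after round \<open>n\<close> is used in round \<open>n + 1\<close>: the multiplier of round \<open>t\<close> is \<open>lam v p (t - 1)\<close>.
  In \<open>play v p t\<close> the decision is set to \<open>0\<close> once the algorithm has stopped, so that all sums range over \<open>{1..T}\<close>.
\<close>

definition lam :: "(nat \<Rightarrow> real) \<Rightarrow> (nat \<Rightarrow> real) \<Rightarrow> nat \<Rightarrow> real" where
  "lam v p n = fst (st v p n)"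

definition budget :: "(nat \<Rightarrow> real) \<Rightarrow> (nat \<Rightarrow> real) \<Rightarrow> nat \<Rightarrow> real" where
  "budget v p n = fst (snd (st v p n))"

definition act :: "(nat \<Rightarrow> real) \<Rightarrow> (nat \<Rightarrow> real) \<Rightarrow> nat \<Rightarrow> bool" where
  "act v p n = snd (snd (snd (st v p n)))"

definition play :: "(nat \<Rightarrow> real) \<Rightarrow> (nat \<Rightarrow> real) \<Rightarrow> nat \<Rightarrow> real" where
  "play v p t = (if act v p (t - 1) then ogd_x T p (lam v p (t - 1)) {1..t - 1} t (v t) else 0)"

text \<open>A uniform bound on the multipliers: an increasing step starts from at most
  \<open>3 / 2 * (vbar / rho)\<close> and adds at most 1.\<close>

definition "Lam = 3 / 2 * (vbar / rho) + 1"

definition "rev_gap_max = (2 + Lam) * vbar"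

text \<open>The collected coefficients of \<open>sqrt (T * ln T)\<close>: the reward martingale,
  gradient descent, optimism about rewards and, scaled by \<open>vbar / rho\<close>, the loss from
  stopping early.\<close>

definition "regret_const = sqrt 2 * rev_gap_max + vbar * (Lam\<^sup>2 / 2 + 20) + 6 * vbar + vbar / rho * (11 * vbar + sqrt 2 * vbar)"

text \<open>The observed set is frozen after stopping, so equality with \<open>{1..n}\<close> is
  claimed only for running states.\<close>

lemma st_observed_subset: "fst (snd (snd (st v p n))) \<subseteq> {1..n}"
  by (induction n) (auto simp: Let_def split: prod.splits)

lemma st_observed: "act v p n \<Longrightarrow> fst (snd (snd (st v p n))) = {1..n}"
  unfolding act_def by (induction n) (auto simp: Let_def split: prod.splits if_splits)

lemma st_eq: "act v p n \<Longrightarrow> st v p n = (lam v p n, budget v p n, {1..n}, True)"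
  using st_observed[of v p n] unfolding lam_def budget_def act_def by (simp add: prod_eq_iff)

lemma state_0 [simp]: "lam v p 0 = 0" "budget v p 0 = rho * T" "act v p 0"
  by (simp_all add: lam_def budget_def act_def)

lemma act_Suc: "act v p (Suc n) \<longleftrightarrow> act v p n \<and> \<not> budget v p (Suc n) < vbar"
  by (auto simp: act_def budget_def Let_def split: prod.splits)

lemma budget_Suc: "budget v p (Suc n) = budget v p n - play v p (Suc n) * cst (v (Suc n)) (p (Suc n))"
proof (cases "act v p n")
  case True
  then show ?thesis
    using st_eq[OF True] by (simp add: play_def budget_def[of v p "Suc n"] Let_def)
next
  case False
  then show ?thesis
    by (auto simp: play_def budget_def act_def Let_def split: prod.splits)
qed

lemma lam_Suc:
  "lam v p (Suc n) =
     (if act v p n \<and> n \<noteq> 0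
      then max 0 (lam v p n + 1 / (vbar * sqrt (Suc n)) * (play v p (Suc n) * tilde_c T p {1..n} (v (Suc n)) - rho))
      else lam v p n)"
proof (cases "act v p n")
  case True
  then show ?thesis
    using st_eq[OF True] by (simp add: play_def lam_def[of v p "Suc n"] Let_def)
next
  case False
  then show ?thesis
    by (auto simp: play_def lam_def act_def Let_def split: prod.splits)
qed

lemma revenue_eq: "ogd_revenue True vbar rho T v p = (\<Sum>t=1..T. play v p t * rew (v t) (p t))"
  unfolding ogd_revenue_def
proof (intro sum.cong refl)
  fix t assume "t \<in> {1..T}"
  show "(case st v p (t - 1) of (l, B, I, a) \<Rightarrow> if a then ogd_x T p l I t (v t) * rew (v t) (p t) else 0)
      = play v p t * rew (v t) (p t)"
  proof (cases "act v p (t - 1)")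
    case True
    show ?thesis using True by (simp only: st_eq[OF True]) (simp add: play_def)
  next
    case False
    then show ?thesis by (auto simp: play_def act_def split: prod.splits)
  qed
qed

text \<open>Non-anticipation, which later makes the martingale differences adapted.\<close>

lemma st_cong:
  assumes "\<And>i. i \<in> {1..n} \<Longrightarrow> v i = v' i \<and> p i = p' i"
  shows "st v p n = st v' p' n"
  using assms
proof (induction n)
  case (Suc n)
  have IH: "st v p n = st v' p' n" using Suc by auto
  obtain l B I a where st: "st v p n = (l, B, I, a)" using prod_cases4 by blast
  have I: "I \<subseteq> {1..n}" using st_observed_subset[of v p n] st by simp
  have "tilde_r T p I u = tilde_r T p' I u" "tilde_c T p I u = tilde_c T p' I u" for u
    using I Suc.prems unfolding tilde_r_def tilde_c_def
    by (auto intro!: sum.cong arg_cong2[where f="(/)"])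
  then show ?case using IH[symmetric] st Suc.prems[of "Suc n"]
    by (simp add: ogd_x_def)
qed simp

lemma play_01: "play v p t = 0 \<or> play v p t = 1"
  by (simp add: play_def ogd_x_def)

lemma lam_nonneg: "lam v p n \<ge> 0"
  by (induction n) (auto simp: lam_Suc)

text \<open>No concentration is involved: in an increasing step the decision rule itself caps
  \<open>lam * rho\<close> by \<open>tilde_r\<close>, and the crude bounds
  \<open>rew v p \<le> v\<close> and \<open>cst v p \<le> v\<close> do the rest on every
  path.\<close>

lemma lam_le:
  assumes "\<And>i. i \<in> {1..n} \<Longrightarrow> 0 \<le> v i \<and> v i \<le> vbar \<and> 0 \<le> p i"
  shows "lam v p n \<le> Lam"
  using assms
proof (induction n)
  case 0
  show ?case using vbar rho by (simp add: Lam_def)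
next
  case (Suc n)
  have IH: "lam v p n \<le> Lam" using Suc by auto
  define e c r t where "e = ocb_eps T {1..n}" and "c = tilde_c T p {1..n} (v (Suc n))"
    and "r = tilde_r T p {1..n} (v (Suc n))" and "t = 1 / (vbar * sqrt (Suc n))"
  have v: "0 \<le> v (Suc n)" "v (Suc n) \<le> vbar" using Suc.prems by auto
  have t: "0 < t" "t \<le> 1 / vbar" using vbar by (auto simp: t_def field_simps)
  have Lam0: "0 \<le> Lam" using vbar rho by (simp add: Lam_def)
  \<comment> \<open>The multiplier is frozen, or the gradient is not positive, or it is positive;
    only the last case can increase it.\<close>
  consider "\<not> (act v p n \<and> n \<noteq> 0)" | "n \<noteq> 0" "play v p (Suc n) * c \<le> rho"
    | "act v p n" "n \<noteq> 0" "play v p (Suc n) * c > rho" by linarith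
  then show ?case
  proof cases
    case 1
    then show ?thesis using IH by (auto simp: lam_Suc)
  next
    case 2
    have "t * (play v p (Suc n) * c - rho) \<le> 0"
      using t 2 by (intro mult_nonneg_nonpos) auto
    then show ?thesis using IH Lam0 unfolding lam_Suc c_def[symmetric] t_def[symmetric] by auto
  next
    case 3
    have "play v p (Suc n) = 1" using play_01[of v p "Suc n"] 3 rho by auto
    then have x: "lam v p n * c \<le> r"
      using 3 by (auto simp: play_def ogd_x_def r_def c_def split: if_splits)
    have c: "rho < c" using \<open>play v p (Suc n) = 1\<close> 3 by simp
    have "(\<Sum>i=1..n. cst (v (Suc n)) (p i)) \<le> (\<Sum>i=1..n. v (Suc n))"
      using v by (intro sum_mono) (auto simp: cst_def)
    then have c_le: "c \<le> v (Suc n) - 2 * e * v (Suc n)"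
      using 3 by (simp add: c_def tilde_c_def e_def field_simps)
    have "(\<Sum>i=1..n. rew (v (Suc n)) (p i)) \<le> (\<Sum>i=1..n. v (Suc n))"
      using v Suc.prems by (intro sum_mono) (auto simp: rew_def)
    then have r_le: "r \<le> v (Suc n) + e * v (Suc n)"
      using 3 by (simp add: r_def tilde_r_def e_def field_simps)
    have "0 < v (Suc n) * (1 - 2 * e)" using c c_le rho by (simp add: algebra_simps)
    then have e: "e < 1 / 2" using v by (simp add: zero_less_mult_iff)
    have "lam v p n * rho \<le> lam v p n * c" using c lam_nonneg by (intro mult_left_mono) auto
    also have "\<dots> \<le> v (Suc n) * (1 + e)" using x r_le by (simp add: algebra_simps)
    also have "\<dots> \<le> v (Suc n) * (3 / 2)" using e v by (intro mult_left_mono) auto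
    also have "\<dots> \<le> 3 / 2 * vbar" using v by simp
    finally have l: "lam v p n \<le> 3 / 2 * (vbar / rho)" using rho by (simp add: field_simps)
    have "t * (c - rho) \<le> 1 / vbar * vbar"
      using t c c_le v rho vbar mult_nonneg_nonneg[OF ocb_eps_nonneg v(1), of T "{1..n}"]
      by (intro mult_mono) (auto simp: e_def)
    then have "lam v p n + t * (c - rho) \<le> Lam" using l vbar by (simp add: Lam_def)
    then show ?thesis
      using 3 Lam0 \<open>play v p (Suc n) = 1\<close> unfolding lam_Suc c_def[symmetric] t_def[symmetric] by simp
  qed
qed

section \<open>The regret inequality on a single path\<close>

definition "deviation p f \<mu> t u \<longleftrightarrow> \<bar>(\<Sum>\<tau>=1..t - 1. f u (p \<tau>)) / real (t - 1) - \<mu> u\<bar> > ocb_eps T {1..t - 1} * u"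
  for p :: "nat \<Rightarrow> real" and f :: "real \<Rightarrow> real \<Rightarrow> real" and \<mu> :: "real \<Rightarrow> real" and t :: nat and u :: real

text \<open>The martingale differences behind the regret bound; once \<open>Rp\<close> and \<open>Cp\<close> are the expectations
  of \<open>\<pi> r\<close> and \<open>\<pi> c\<close>, both terms have conditional mean \<open>0\<close>.\<close>

definition "rev_term r c \<pi> Rp Cp v p t =
  play v p t * (r (v t) - rew (v t) (p t)) +
  (if act v p (t - 1) then (Rp - \<pi> (v t) * r (v t)) - lam v p (t - 1) * (Cp - \<pi> (v t) * c (v t)) else 0)"
  for r c \<pi> v p :: "_ \<Rightarrow> real"

definition "cost_term c v p t = play v p t * (cst (v t) (p t) - c (v t))"
  for c v p :: "_ \<Rightarrow> real"

definition "eps_sum = (\<Sum>t=2..T. ocb_eps T {1..t - 1})"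

text \<open>The bound of \<open>projected_ogd_regret\<close> for \<open>L = Lam\<close>, step sizes
  \<open>1 / (vbar * sqrt t)\<close> and gradients of size at most
  \<open>vbar * (1 + 2 * ocb_eps T {1..t - 1})\<close>.\<close>

definition "ogd_err = Lam\<^sup>2 * (vbar * sqrt T) / 2
  + (\<Sum>t=2..T. 1 / (vbar * sqrt t) * (vbar * (1 + 2 * ocb_eps T {1..t - 1}))\<^sup>2) / 2"

text \<open>Deterministic: randomness enters only through the confidence event \<open>est\<close>
  and the martingale bounds \<open>Z1\<close> and \<open>Z2\<close>. With \<open>N\<close> the
  number of rounds played and \<open>W\<close> the sum of \<open>l t * g t\<close>, the greedy rule
  bounds \<open>N * Rp\<close> minus the revenue by \<open>Z1 - W\<close> plus the price of
  optimism. Gradient descent then controls \<open>- W\<close> together with the \<open>T - N\<close>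
  lost rounds.\<close>

lemma regret_le:
  fixes r c \<pi> v p :: "_ \<Rightarrow> real" and Rp Cp Z1 Z2 :: real
  assumes T: "2 \<le> T"
    and v: "\<And>t. t \<in> {1..T} \<Longrightarrow> 0 \<le> v t \<and> v t \<le> vbar"
    and p: "\<And>t. t \<in> {1..T} \<Longrightarrow> 0 \<le> p t \<and> p t \<le> vbar"
    and r: "\<And>u. 0 \<le> u \<Longrightarrow> u \<le> vbar \<Longrightarrow> 0 \<le> r u"
    and c: "\<And>u. 0 \<le> u \<Longrightarrow> u \<le> vbar \<Longrightarrow> c u \<le> vbar"
    and est: "\<And>t. t \<in> {2..T} \<Longrightarrow> \<not> deviation p rew r t (v t) \<and> \<not> deviation p cst c t (v t)"
    and \<pi>: "\<And>u. 0 \<le> \<pi> u \<and> \<pi> u \<le> 1"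
    and Rp: "Rp \<le> vbar" and Cp: "Cp \<le> rho"
    and Z1: "(\<Sum>t=1..T. rev_term r c \<pi> Rp Cp v p t) \<le> Z1"
    and Z2: "(\<Sum>t=1..T. cost_term c v p t) \<le> Z2" "0 \<le> Z2"
  shows "T * Rp - ogd_revenue True vbar rho T v p
    \<le> Z1 + ogd_err + 2 * vbar * eps_sum + vbar / rho * (2 * vbar + Z2 + 3 * vbar * eps_sum)"
proof -
  define a where "a t = (if act v p (t - 1) then 1 else 0 :: real)" for t
  define l where "l t = lam v p (t - 1)" for t
  define e where "e t = ocb_eps T {1..t - 1}" for t
  define ct where "ct t = tilde_c T p {1..t - 1} (v t)" for t
  define rt where "rt t = tilde_r T p {1..t - 1} (v t)" for t
  define x where "x = play v p"
  define g where "g t = a t * (x t * ct t - rho)" for t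
  have a01: "a t = 0 \<or> a t = 1" for t by (simp add: a_def)
  have ax: "a t * x t = x t" for t by (simp add: a_def x_def play_def)
  have x01: "x t = 0 \<or> x t = 1" for t using play_01 by (simp add: x_def)
  have l0: "0 \<le> l t" for t by (simp add: l_def lam_nonneg)
  have e0: "0 \<le> e t" for t by (simp add: e_def ocb_eps_nonneg)
  have a1: "a 1 = 1" "l 1 = 0" "x 1 = 1" by (simp_all add: a_def l_def x_def play_def ogd_x_def)
  \<comment> \<open>Round 1 is split off: it has no estimates and no multiplier update.\<close>
  have sum1: "(\<Sum>t=1..T. f t) = f 1 + (\<Sum>t=2..T. f t)" for f :: "nat \<Rightarrow> real"
    using T by (subst sum.atLeast_Suc_atMost) (auto simp: numeral_2_eq_2)
  have c_est: "c (v t) - 3 * e t * v t \<le> ct t" "ct t \<le> c (v t)" if "t \<in> {2..T}" for t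
  proof -
    have "\<bar>(\<Sum>\<tau>=1..t - 1. cst (v t) (p \<tau>)) / real (t - 1) - c (v t)\<bar> \<le> e t * v t"
      using est[OF that] by (simp add: deviation_def e_def)
    moreover have "ct t = (\<Sum>\<tau>=1..t - 1. cst (v t) (p \<tau>)) / real (t - 1) - 2 * (e t * v t)"
      by (simp add: ct_def tilde_c_def e_def)
    moreover have "0 \<le> e t * v t" using v[of t] that e0[of t] by simp
    ultimately show "c (v t) - 3 * e t * v t \<le> ct t" "ct t \<le> c (v t)" by (simp_all add: abs_le_iff)
  qed
  have r_est: "r (v t) \<le> rt t" "rt t \<le> r (v t) + 2 * e t * v t" if "t \<in> {2..T}" for t
  proof -
    have "\<bar>(\<Sum>\<tau>=1..t - 1. rew (v t) (p \<tau>)) / real (t - 1) - r (v t)\<bar> \<le> e t * v t"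
      using est[OF that] by (simp add: deviation_def e_def)
    moreover have "rt t = (\<Sum>\<tau>=1..t - 1. rew (v t) (p \<tau>)) / real (t - 1) + e t * v t"
      by (simp add: rt_def tilde_r_def e_def)
    ultimately show "r (v t) \<le> rt t" "rt t \<le> r (v t) + 2 * e t * v t" by (simp_all add: abs_le_iff)
  qed
  have ct_bounds: "- (2 * e t * vbar) \<le> ct t" "ct t \<le> vbar" if t: "t \<in> {2..T}" for t
  proof -
    have "(\<Sum>\<tau>=1..t - 1. cst (v t) (p \<tau>)) \<ge> 0"
      using p t by (intro sum_nonneg) (auto simp: cst_def)
    then have "- (2 * e t * v t) \<le> ct t"
      by (simp add: ct_def tilde_c_def e_def)
    moreover have "e t * v t \<le> e t * vbar" using v[of t] t e0[of t] by (intro mult_left_mono) auto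
    ultimately show "- (2 * e t * vbar) \<le> ct t" by simp
    show "ct t \<le> vbar" using c_est(2)[OF t] c[of "v t"] v[of t] t by auto
  qed
  have g_bound: "\<bar>g t\<bar> \<le> vbar * (1 + 2 * e t)" if t: "t \<in> {2..T}" for t
    using ct_bounds[OF t] a01[of t] x01[of t] rho vbar mult_nonneg_nonneg[OF e0[of t], of vbar]
    by (auto simp: g_def abs_le_iff algebra_simps)
  \<comment> \<open>\<open>x t\<close> maximises \<open>y * (rt t - l t * ct t)\<close> over
    \<open>y\<close> in \<open>[0, 1]\<close>, so it does at least as well as
    \<open>\<pi> (v t)\<close>. Using \<open>Cp \<le> rho\<close> puts the mean \<open>Cp\<close> in
    place of \<open>rho\<close>, so that the cost term of the policy is centred.\<close>
  have per_round: "\<pi> (v t) * r (v t) * a t + a t * l t * (Cp - \<pi> (v t) * c (v t)) + l t * g t - 2 * vbar * e t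
      \<le> x t * r (v t)" if t: "t \<in> {2..T}" for t
  proof (cases "a t = 0")
    case True
    then show ?thesis
      using ax[of t] e0[of t] vbar by (simp add: g_def)
  next
    case False
    then have at: "a t = 1" using a01 by auto
    have max: "\<pi> (v t) * (rt t - l t * ct t) \<le> x t * (rt t - l t * ct t)"
    proof (cases "rt t \<ge> l t * ct t")
      case True
      then have "x t = 1" using at t
        by (auto simp: x_def play_def ogd_x_def a_def rt_def l_def ct_def split: if_splits)
      then show ?thesis using True \<pi>[of "v t"] mult_right_mono[of "\<pi> (v t)" 1 "rt t - l t * ct t"] by simp
    next
      case F: False
      then have "x t = 0" using at t
        by (auto simp: x_def play_def ogd_x_def a_def rt_def l_def ct_def split: if_splits)
      then show ?thesis using F \<pi>[of "v t"] mult_nonneg_nonpos[of "\<pi> (v t)" "rt t - l t * ct t"] by simp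
    qed
    have "\<pi> (v t) * (r (v t) - l t * c (v t)) \<le> \<pi> (v t) * (rt t - l t * ct t)"
      using r_est(1)[OF t] c_est(2)[OF t] l0[of t] \<pi>[of "v t"]
      by (intro mult_left_mono diff_mono mult_left_mono) auto
    also note max
    also have "x t * (rt t - l t * ct t) \<le> x t * r (v t) + 2 * vbar * e t - l t * (x t * ct t)"
    proof -
      have "e t * v t \<le> e t * vbar" using v[of t] t e0[of t] by (intro mult_left_mono) auto
      then have "x t * rt t \<le> x t * r (v t) + 2 * vbar * e t"
        using x01[of t] r_est(2)[OF t] vbar e0[of t] by (auto simp: algebra_simps)
      then show ?thesis by (simp add: algebra_simps)
    qed
    finally have 1: "\<pi> (v t) * (r (v t) - l t * c (v t)) \<le> x t * r (v t) + 2 * vbar * e t - l t * (x t * ct t)" .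
    have "l t * Cp \<le> l t * rho" using Cp l0 by (intro mult_left_mono) auto
    with 1 show ?thesis using at by (simp add: g_def algebra_simps)
  qed
  have round1: "\<pi> (v 1) * r (v 1) * a 1 + a 1 * l 1 * (Cp - \<pi> (v 1) * c (v 1)) \<le> x 1 * r (v 1)"
    using a1 r[of "v 1"] v[of 1] T \<pi>[of "v 1"] mult_right_mono[of "\<pi> (v 1)" 1 "r (v 1)"] by simp
  define W where "W = (\<Sum>t=2..T. l t * g t)"
  have "(\<Sum>t=1..T. \<pi> (v t) * r (v t) * a t + a t * l t * (Cp - \<pi> (v t) * c (v t))) + W - 2 * vbar * eps_sum
      \<le> (\<Sum>t=1..T. x t * r (v t))"
  proof -
    have "(\<Sum>t=2..T. \<pi> (v t) * r (v t) * a t + a t * l t * (Cp - \<pi> (v t) * c (v t)) + l t * g t - 2 * vbar * e t)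
        \<le> (\<Sum>t=2..T. x t * r (v t))"
      by (intro sum_mono per_round)
    then show ?thesis
      unfolding sum1 W_def eps_sum_def e_def[symmetric] sum_distrib_left using round1
      by (simp add: sum.distrib sum_subtractf)
  qed
  \<comment> \<open>The martingale sum trades expected for realised rewards, and the policy's
    rewards for their mean \<open>Rp\<close>.\<close>
  moreover have "(\<Sum>t=1..T. rev_term r c \<pi> Rp Cp v p t) = (\<Sum>t=1..T. x t * r (v t)) - (\<Sum>t=1..T. x t * rew (v t) (p t))
      + (\<Sum>t=1..T. a t) * Rp - (\<Sum>t=1..T. \<pi> (v t) * r (v t) * a t + a t * l t * (Cp - \<pi> (v t) * c (v t)))"
    unfolding sum_distrib_right sum_subtractf[symmetric] sum.distrib[symmetric]
    by (intro sum.cong refl) (auto simp: rev_term_def x_def a_def l_def algebra_simps)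
  ultimately have main: "(\<Sum>t=1..T. a t) * Rp - (\<Sum>t=1..T. x t * rew (v t) (p t)) \<le> Z1 - W + 2 * vbar * eps_sum"
    using Z1 by simp

  have ogd: "(\<Sum>t=2..T. g t * (mu - l t)) \<le> ogd_err" if mu: "0 \<le> mu" "mu \<le> Lam" for mu
  proof -
    \<comment> \<open>The value at 0 is patched because step sizes must be positive at every
      index.\<close>
    define eta where "eta t = 1 / (vbar * (if t = 0 then 1 else sqrt (real t)))" for t :: nat
    \<comment> \<open>This also holds after stopping: there \<open>g t = 0\<close> and the
      multiplier is frozen and nonnegative.\<close>
    have upd: "l (Suc t) = max 0 (l t + eta t * g t)" if "2 \<le> t" "t \<le> T" for t
    proof -
      obtain n where "t = Suc n" using \<open>2 \<le> t\<close> by (cases t) auto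
      with that have n: "t = Suc n" "n \<noteq> 0" by auto
      show ?thesis
        using lam_Suc[of v p n] l0[of t] by (auto simp: n l_def a_def g_def x_def ct_def eta_def)
    qed
    have "(\<Sum>t=2..T. g t * (mu - l t)) \<le> Lam\<^sup>2 / (2 * eta T) + (\<Sum>t=2..T. eta t * (g t)\<^sup>2) / 2"
    proof (rule projected_ogd_regret)
      show "l (Suc t) = max 0 (l t + eta t * g t)" if "2 \<le> t" "t \<le> T" for t
        using upd that .
      show "eta t > 0" for t using vbar by (simp add: eta_def)
      show "eta (Suc t) \<le> eta t" if "2 \<le> t" for t
        using vbar that by (simp add: eta_def frac_le)
      show "0 \<le> l t \<and> l t \<le> Lam" if "t \<le> Suc T" for t
      proof -
        have "lam v p (t - 1) \<le> Lam"
        proof (rule lam_le)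
          fix i assume "i \<in> {1..t - 1}"
          with that have "i \<in> {1..T}" by auto
          then show "0 \<le> v i \<and> v i \<le> vbar \<and> 0 \<le> p i" using v p by blast
        qed
        then show ?thesis using l0[of t] by (simp add: l_def)
      qed
    qed (use mu T in auto)
    also have "(\<Sum>t=2..T. eta t * (g t)\<^sup>2) \<le> (\<Sum>t=2..T. 1 / (vbar * sqrt t) * (vbar * (1 + 2 * e t))\<^sup>2)"
    proof (intro sum_mono)
      fix t assume t: "t \<in> {2..T}"
      have "(g t)\<^sup>2 \<le> (vbar * (1 + 2 * e t))\<^sup>2"
        using g_bound[OF t] abs_ge_zero[of "g t"] by (intro abs_le_square_iff[THEN iffD1]) linarith
      moreover have "eta t = 1 / (vbar * sqrt t)" "0 \<le> 1 / (vbar * sqrt t)"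
        using t vbar by (auto simp: eta_def)
      ultimately show "eta t * (g t)\<^sup>2 \<le> 1 / (vbar * sqrt t) * (vbar * (1 + 2 * e t))\<^sup>2"
        by (metis mult_left_mono)
    qed
    finally show ?thesis
      using T by (simp add: ogd_err_def e_def eta_def)
  qed
  have ogdW: "mu * (\<Sum>t=2..T. g t) - W \<le> ogd_err" if "0 \<le> mu" "mu \<le> Lam" for mu
    using ogd[OF that] by (simp add: W_def sum_distrib_left sum_subtractf right_diff_distrib mult.commute)
  have es0: "0 \<le> eps_sum" by (auto simp: eps_sum_def intro!: sum_nonneg ocb_eps_nonneg)
  define N where "N = (\<Sum>t=1..T. a t)"
  have "N \<le> (\<Sum>t=1..T. 1)" unfolding N_def by (intro sum_mono) (simp add: a_def)
  then have N: "N \<le> T" by simp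
  \<comment> \<open>If the algorithm is still running after round \<open>T\<close>, no round is lost
    and the comparator 0 suffices. Otherwise the spent budget forces a large gradient sum, which the
    comparator \<open>vbar / rho\<close> converts into payment for the lost rounds.\<close>
  have stop: "vbar * (T - N) - W \<le> ogd_err + vbar / rho * (2 * vbar + Z2 + 3 * vbar * eps_sum)"
  proof (cases "act v p T")
    case True
    have "act v p n" if "n \<le> T" for n
      using that True by (induction n rule: inc_induct) (auto simp: act_Suc)
    then have "N = (\<Sum>t=1..T. 1)"
      unfolding N_def by (intro sum.cong) (auto simp: a_def)
    then have "N = T" by simp
    moreover have "0 \<le> vbar / rho * (2 * vbar + Z2 + 3 * vbar * eps_sum)"
      using vbar rho Z2 es0 by simp
    ultimately show ?thesis
      using ogdW[of 0] vbar rho by (simp add: Lam_def)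
  next
    case False
    have budget_sum: "budget v p n = rho * T - (\<Sum>t=1..n. x t * cst (v t) (p t))" for n
      by (induction n) (simp_all add: budget_Suc x_def)
    have "budget v p n < vbar" if "\<not> act v p n" for n
      using that
    proof (induction n)
      case (Suc n)
      show ?case
      proof (cases "act v p n")
        case True
        with Suc.prems show ?thesis by (simp add: act_Suc)
      next
        case F: False
        then show ?thesis using Suc.IH by (simp add: budget_Suc play_def)
      qed
    qed simp
    from this[OF False] have "rho * T - vbar \<le> (\<Sum>t=1..T. x t * cst (v t) (p t))"
      unfolding budget_sum by simp
    also have "\<dots> \<le> (\<Sum>t=1..T. x t * c (v t)) + Z2"
      using Z2 by (simp add: cost_term_def x_def right_diff_distrib sum_subtractf)
    also have "(\<Sum>t=1..T. x t * c (v t)) \<le> vbar + (\<Sum>t=2..T. g t + rho * a t + 3 * vbar * e t)"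
    proof -
      have "c (v 1) \<le> vbar" using c[of "v 1"] v[of 1] T by auto
      moreover have "(\<Sum>t=2..T. x t * c (v t)) \<le> (\<Sum>t=2..T. g t + rho * a t + 3 * vbar * e t)"
      proof (intro sum_mono)
        fix t assume t: "t \<in> {2..T}"
        have "e t * v t \<le> e t * vbar" using v[of t] t e0[of t] by (intro mult_left_mono) auto
        then have "x t * c (v t) \<le> x t * ct t + 3 * vbar * e t"
          using x01[of t] c_est(1)[OF t] vbar e0[of t] by (auto simp: algebra_simps)
        also have "x t * ct t = g t + rho * a t"
          using a01[of t] ax[of t] by (auto simp: g_def algebra_simps)
        finally show "x t * c (v t) \<le> g t + rho * a t + 3 * vbar * e t" .
      qed
      ultimately show ?thesis unfolding sum1 a1 by simp
    qed
    also have "(\<Sum>t=2..T. g t + rho * a t + 3 * vbar * e t)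
        = (\<Sum>t=2..T. g t) + rho * (N - 1) + 3 * vbar * eps_sum"
      unfolding N_def sum1 a1 by (simp add: sum.distrib sum_distrib_left eps_sum_def e_def)
    \<comment> \<open>One \<open>vbar\<close> is the budget that may be left unspent, the other the
      cost of round 1.\<close>
    finally have "rho * (T - N) \<le> (\<Sum>t=2..T. g t) + (2 * vbar + Z2 + 3 * vbar * eps_sum)"
      using rho by (simp add: algebra_simps)
    \<comment> \<open>The factor is chosen to price each lost round at \<open>vbar\<close>, an upper
      bound for \<open>Rp\<close>.\<close>
    then have "vbar / rho * (rho * (T - N)) \<le> vbar / rho * ((\<Sum>t=2..T. g t) + (2 * vbar + Z2 + 3 * vbar * eps_sum))"
      using vbar rho by (intro mult_left_mono) auto
    moreover have "vbar / rho \<le> Lam"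
    proof -
      have "0 < vbar / rho" using vbar rho by simp
      then show ?thesis by (simp add: Lam_def)
    qed
    then have "vbar / rho * (\<Sum>t=2..T. g t) - W \<le> ogd_err"
      using vbar rho by (intro ogdW) auto
    ultimately show ?thesis using rho by (simp add: distrib_left)
  qed
  have "(T - N) * Rp \<le> (T - N) * vbar" using N Rp by (intro mult_left_mono) auto
  then show ?thesis
    using main stop unfolding revenue_eq x_def[symmetric] N_def[symmetric] by (simp add: algebra_simps)
qed

section \<open>Size of the error terms when \<open>T\<close> is at least 3\<close>

lemma ocb_eps_sq_le:
  assumes "3 \<le> T" "1 \<le> n"
  shows "(ocb_eps T {1..n})\<^sup>2 \<le> 3 / 2 * ln T / n"
proof -
  have "ln 2 \<le> ln (real T)" using assms by (subst ln_le_cancel_iff) auto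
  moreover have "0 \<le> ln (2::real)" by simp
  ultimately have "0 \<le> ln 2 + 2 * ln (real T)" by linarith
  then have "(ocb_eps T {1..n})\<^sup>2 = (ln 2 + 2 * ln T) / (2 * n)"
    unfolding ocb_eps_def by (subst real_sqrt_pow2) auto
  also have "\<dots> \<le> (3 * ln T) / (2 * n)"
    using assms \<open>ln 2 \<le> ln (real T)\<close> by (intro divide_right_mono) auto
  finally show ?thesis by simp
qed

context
  assumes T3: "3 \<le> T"
begin

text \<open>\<open>T\<close> is at least 3 and hence exceeds the base of the logarithm; this lets
  \<open>sqrt (T * ln T)\<close> dominate all lower-order terms.\<close>

lemma ln_T_ge_1: "1 \<le> ln (real T)"
proof -
  have "exp 1 \<le> real T" using exp_le T3 by linarith
  then show ?thesis using T3 by (subst ln_ge_iff) auto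
qed

lemma sqrt_T_le: "sqrt T \<le> sqrt (T * ln T)"
  using ln_T_ge_1 mult_left_mono[of 1 "ln (real T)" "real T"] by (intro real_sqrt_le_mono) simp

lemma ln_T_le: "ln T \<le> sqrt (T * ln T)"
proof (rule real_le_rsqrt)
  have "ln (real T) \<le> real T" using T3 ln_bound by simp
  then show "(ln T)\<^sup>2 \<le> T * ln T"
    using ln_T_ge_1 by (simp add: power2_eq_square mult_right_mono)
qed

lemma shift_sum: "(\<Sum>t=2..T. f t) = (\<Sum>n=1..T - 1. f (Suc n))" for f :: "nat \<Rightarrow> real"
proof -
  have "{2..T} = {Suc 1..Suc (T - 1)}" using T3 by auto
  then show ?thesis by (simp only: sum.shift_bounds_cl_Suc_ivl)
qed

lemma eps_sum_le: "eps_sum \<le> 3 * sqrt (T * ln T)"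
proof -
  have "eps_sum = (\<Sum>n=1..T - 1. ocb_eps T {1..n})"
    unfolding eps_sum_def shift_sum by simp
  also have "\<dots> \<le> (\<Sum>n=1..T - 1. sqrt (3 / 2 * ln T) * (1 / sqrt n))"
  proof (intro sum_mono)
    fix n assume "n \<in> {1..T - 1}"
    then have "ocb_eps T {1..n} \<le> sqrt (3 / 2 * ln T / n)"
      using T3 by (intro real_le_rsqrt ocb_eps_sq_le) auto
    then show "ocb_eps T {1..n} \<le> sqrt (3 / 2 * ln T) * (1 / sqrt n)"
      by (simp only: real_sqrt_divide times_divide_eq_right mult_1_right)
  qed
  also have "\<dots> \<le> sqrt (3 / 2 * ln T) * (2 * sqrt (T - 1))"
    using T3 ln_T_ge_1 sum_inverse_sqrt[of "T - 1"]
    unfolding sum_distrib_left[symmetric] by (intro mult_left_mono) auto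
  also have "\<dots> \<le> sqrt (3 / 2 * ln T) * (2 * sqrt T)"
    using ln_T_ge_1 by (intro mult_left_mono) auto
  also have "\<dots> = sqrt (3 / 2) * 2 * sqrt (T * ln T)"
    by (simp add: real_sqrt_mult real_sqrt_divide)
  \<comment> \<open>The constant is rounded up using
    \<open>sqrt (3 / 2) \<le> 3 / 2\<close>.\<close>
  also have "\<dots> \<le> 3 / 2 * 2 * sqrt (T * ln T)"
    using ln_T_ge_1 by (intro mult_right_mono real_le_lsqrt) (auto simp: power2_eq_square)
  finally show ?thesis by simp
qed

lemma ogd_err_le: "ogd_err \<le> vbar * (Lam\<^sup>2 / 2 + 20) * sqrt (T * ln T)"
proof -
  let ?Q = "sqrt (T * ln T)"
  have "(\<Sum>t=2..T. 1 / (vbar * sqrt t) * (vbar * (1 + 2 * ocb_eps T {1..t - 1}))\<^sup>2)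
      = (\<Sum>n=1..T - 1. vbar * ((1 + 2 * ocb_eps T {1..n})\<^sup>2 / sqrt (Suc n)))"
    unfolding shift_sum using vbar by (intro sum.cong) (auto simp: power2_eq_square field_simps)
  also have "\<dots> \<le> (\<Sum>n=1..T - 1. vbar * (2 * (1 / sqrt n) + 12 * ln T * (1 / (n * sqrt n))))"
  proof (intro sum_mono mult_left_mono)
    fix n assume n: "n \<in> {1..T - 1}"
    define e where "e = ocb_eps T {1..n}"
    \<comment> \<open>Splitting the square separates a part of order \<open>1 / sqrt n\<close> from
      a part \<open>ln T / (n * sqrt n)\<close>, whose sum over \<open>n\<close> is of order
      \<open>ln T\<close> only.\<close>
    have "0 \<le> (1 - 2 * e)\<^sup>2" by simp
    then have "(1 + 2 * e)\<^sup>2 \<le> 2 + 8 * e\<^sup>2"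
      by (simp add: power2_eq_square algebra_simps)
    also have "\<dots> \<le> 2 + 12 * ln T / n"
      using ocb_eps_sq_le[of n] n T3 by (simp add: e_def)
    finally have "(1 + 2 * e)\<^sup>2 / sqrt (Suc n) \<le> (2 + 12 * ln T / n) / sqrt n"
      using n ln_T_ge_1 by (intro frac_le) auto
    also have "\<dots> = 2 * (1 / sqrt n) + 12 * ln T * (1 / (n * sqrt n))"
      by (simp add: add_divide_distrib)
    finally show "(1 + 2 * ocb_eps T {1..n})\<^sup>2 / sqrt (Suc n) \<le> 2 * (1 / sqrt n) + 12 * ln T * (1 / (n * sqrt n))"
      by (simp add: e_def)
  qed (use vbar in auto)
  also have "\<dots> = vbar * (2 * (\<Sum>n=1..T - 1. 1 / sqrt n) + 12 * ln T * (\<Sum>n=1..T - 1. 1 / (n * sqrt n)))"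
    unfolding sum_distrib_left[symmetric] sum.distrib ..
  also have "\<dots> \<le> vbar * (2 * (2 * ?Q) + 12 * ln T * 3)"
  proof (intro mult_left_mono add_mono)
    have "(\<Sum>n=1..T - 1. 1 / sqrt n) \<le> 2 * sqrt (T - 1)" by (rule sum_inverse_sqrt)
    also have "\<dots> \<le> 2 * ?Q" using sqrt_T_le by (smt (verit) of_nat_diff_real real_sqrt_le_iff of_nat_mono diff_le_self)
    finally show "(\<Sum>n=1..T - 1. 1 / sqrt n) \<le> 2 * ?Q" .
    have "(\<Sum>n=1..T - 1. 1 / (n * sqrt n)) \<le> 3 - 2 / sqrt (T - 1)"
      using T3 by (intro sum_inverse_mult_sqrt) auto
    then show "(\<Sum>n=1..T - 1. 1 / (n * sqrt n)) \<le> 3" by (rule order.trans) simp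
  qed (use vbar ln_T_ge_1 in auto)
  \<comment> \<open>The 40 consists of 4 from the first sum and 36 from the second, as
    \<open>ln T\<close> is at most \<open>sqrt (T * ln T)\<close>.\<close>
  also have "\<dots> \<le> vbar * (40 * ?Q)"
    using ln_T_le vbar by (intro mult_left_mono) auto
  finally have 1: "(\<Sum>t=2..T. 1 / (vbar * sqrt t) * (vbar * (1 + 2 * ocb_eps T {1..t - 1}))\<^sup>2) / 2 \<le> vbar * 20 * ?Q"
    by simp
  have "Lam\<^sup>2 * (vbar * sqrt T) / 2 \<le> Lam\<^sup>2 * (vbar * ?Q) / 2"
    using sqrt_T_le vbar by (intro divide_right_mono mult_left_mono) auto
  with 1 show ?thesis
    unfolding ogd_err_def by (simp add: algebra_simps)
qed

end

end

section \<open>Stochastic values and bids\<close>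

locale ogd_stoch = ogd_full +
  fixes F G :: "real measure" and \<pi> :: "real \<Rightarrow> real"
  assumes F: "prob_space F" and G: "prob_space G"
    and sets_F [measurable_cong]: "sets F = sets borel"
    and sets_G [measurable_cong]: "sets G = sets borel"
    and supp_F: "measure F {0..vbar} = 1" and supp_G: "measure G {0..vbar} = 1"
    and T3: "3 \<le> T"
    and \<pi>_measurable [measurable]: "\<pi> \<in> borel_measurable borel"
    and \<pi>_bounds: "\<And>u. 0 \<le> \<pi> u \<and> \<pi> u \<le> 1"
begin

sublocale FG: pair_prob_space F G
  by (intro pair_prob_space.intro pair_sigma_finite.intro F G prob_space_imp_sigma_finite)

abbreviation "FG \<equiv> F \<Otimes>\<^sub>M G"
abbreviation "Om n \<equiv> PiM {1..n::nat} (\<lambda>_. FG)"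
abbreviation "S \<equiv> {0..vbar} \<times> {0..vbar}"
abbreviation "V (\<omega> :: nat \<Rightarrow> real \<times> real) \<equiv> (\<lambda>t. fst (\<omega> t))"
abbreviation "P (\<omega> :: nat \<Rightarrow> real \<times> real) \<equiv> (\<lambda>t. snd (\<omega> t))"

section \<open>Expected payoffs given the value\<close>

definition mean :: "(real \<Rightarrow> real \<Rightarrow> real) \<Rightarrow> real \<Rightarrow> real" where
  "mean f u = (\<integral>p. f u p \<partial>G)"

definition "Rp = (\<integral>y. \<pi> (fst y) * rew (fst y) (snd y) \<partial>FG)"
definition "Cp = (\<integral>y. \<pi> (fst y) * cst (fst y) (snd y) \<partial>FG)"

lemma prob_FG: "prob_space FG"
  by (rule FG.P.prob_space_axioms)

lemma space_FG [simp]: "space FG = UNIV" "space F = UNIV" "space G = UNIV"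
  using sets_eq_imp_space_eq[OF sets_F] sets_eq_imp_space_eq[OF sets_G] by (auto simp: space_pair_measure)

lemma prob_UNIV [simp]: "measure F UNIV = 1" "measure G UNIV = 1" "measure FG UNIV = 1"
  using FG.M1.prob_space FG.M2.prob_space FG.P.prob_space by simp_all

lemma AE_G: "AE p in G. p \<in> {0..vbar}"
  using FG.M2.prob_eq_1[of "{0..vbar}"] supp_G by (simp add: sets_G)

lemma AE_F: "AE p in F. p \<in> {0..vbar}"
  using FG.M1.prob_eq_1[of "{0..vbar}"] supp_F by (simp add: sets_F)

lemma AE_S: "AE y in FG. y \<in> S"
proof -
  have "AE u in F. AE p in G. (u, p) \<in> S"
    using AE_F by eventually_elim (use AE_G in auto)
  then show ?thesis
    by (intro FG.AE_pair_measure) auto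
qed

text \<open>The common properties of \<open>rew\<close> and \<open>cst\<close>, so that
  measurability and concentration are proved once for both. The range \<open>[0, u]\<close>, rather
  than \<open>[0, vbar]\<close>, is what allows a confidence radius proportional to the value
  \<open>u\<close>.\<close>

definition payoff :: "(real \<Rightarrow> real \<Rightarrow> real) \<Rightarrow> bool" where
  "payoff f \<longleftrightarrow> (\<lambda>y. f (fst y) (snd y)) \<in> borel_measurable (borel \<Otimes>\<^sub>M borel)
     \<and> (\<forall>u p. 0 \<le> u \<longrightarrow> 0 \<le> p \<longrightarrow> 0 \<le> f u p \<and> f u p \<le> u)"

lemma payoff_rew: "payoff rew" and payoff_cst: "payoff cst"
  by (auto simp: payoff_def rew_def cst_def)

lemma payoff_measurable:
  assumes "payoff f" and [measurable]: "g \<in> borel_measurable M" "h \<in> borel_measurable M"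
  shows "(\<lambda>x. f (g x) (h x)) \<in> borel_measurable M"
proof -
  have "(\<lambda>y. f (fst y) (snd y)) \<circ> (\<lambda>x. (g x, h x)) \<in> borel_measurable M"
    using assms(1) unfolding payoff_def
    by (intro measurable_comp[where N="borel \<Otimes>\<^sub>M borel"] borel_measurable_Pair assms(2,3)) auto
  then show ?thesis by (simp add: o_def)
qed

lemma mean_measurable:
  assumes "payoff f"
  shows "mean f \<in> borel_measurable borel"
proof -
  have [measurable]: "(\<lambda>z. f (fst z) (snd z)) \<in> borel_measurable (borel \<Otimes>\<^sub>M G)"
    by (rule payoff_measurable[OF assms]) (auto simp: measurable_cong_sets[OF refl sets_G, symmetric])
  have "(\<lambda>u. \<integral>p. f u p \<partial>G) \<in> borel_measurable borel"
    by (rule FG.M2.borel_measurable_lebesgue_integral) (simp add: case_prod_beta')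
  then show ?thesis by (simp add: mean_def[abs_def])
qed

lemma mean_bounds:
  assumes "payoff f" "0 \<le> u"
  shows "0 \<le> mean f u" "mean f u \<le> u"
proof -
  have AE: "AE p in G. 0 \<le> f u p \<and> f u p \<le> u"
    using AE_G by eventually_elim (use assms in \<open>simp add: payoff_def\<close>)
  have [measurable]: "f u \<in> borel_measurable G"
    by (rule payoff_measurable[OF assms(1), of "\<lambda>_. u" G "\<lambda>p. p", simplified])
  show "0 \<le> mean f u" unfolding mean_def by (rule integral_nonneg_AE) (use AE in auto)
  have "integrable G (f u)"
    by (rule FG.M2.integrable_const_bound[where B=u]) (use AE in auto)
  then have "mean f u \<le> (\<integral>p. u \<partial>G)" unfolding mean_def
    by (intro integral_mono_AE) (use AE in auto)
  then show "mean f u \<le> u" by (simp add: FG.M2.prob_space)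
qed

lemma payoff_box:
  assumes "payoff f" "y \<in> S"
  shows "0 \<le> f (fst y) (snd y) \<and> f (fst y) (snd y) \<le> vbar"
proof -
  have y: "0 \<le> fst y" "0 \<le> snd y" "fst y \<le> vbar"
    using assms(2) by (auto simp: mem_Times_iff)
  have "0 \<le> f (fst y) (snd y) \<and> f (fst y) (snd y) \<le> fst y"
    using assms(1) y unfolding payoff_def by simp
  with y show ?thesis by linarith
qed

lemma mean_box:
  assumes "payoff f" "y \<in> S"
  shows "0 \<le> mean f (fst y) \<and> mean f (fst y) \<le> vbar"
  using mean_bounds[OF assms(1), of "fst y"] assms(2) by (auto simp: mem_Times_iff)

text \<open>By Fubini the bid can be integrated first, since the weight depends on the value alone.
  The weight will be both the policy \<open>\<pi>\<close> and the decision of the algorithm for a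
  fixed history.\<close>

lemma integral_payoff_eq_mean:
  assumes f: "payoff f" and w [measurable]: "w \<in> borel_measurable borel" and wb: "\<And>u. 0 \<le> w u \<and> w u \<le> 1"
  shows "integrable FG (\<lambda>y. w (fst y) * f (fst y) (snd y))"
    and "integrable FG (\<lambda>y. w (fst y) * mean f (fst y))"
    and "(\<integral>y. w (fst y) * f (fst y) (snd y) \<partial>FG) = (\<integral>y. w (fst y) * mean f (fst y) \<partial>FG)"
proof -
  note [measurable] = mean_measurable[OF f]
  have [measurable]: "(\<lambda>y. f (fst y) (snd y)) \<in> borel_measurable FG"
    by (rule payoff_measurable[OF f]) measurable
  have bd: "\<bar>w u * z\<bar> \<le> vbar" if "0 \<le> z" "z \<le> vbar" for u z
    using wb[of u] that mult_mono[of "w u" 1 z vbar] by (simp add: abs_mult)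
  show 1: "integrable FG (\<lambda>y. w (fst y) * f (fst y) (snd y))"
  proof (rule FG.P.integrable_const_bound)
    show "AE y in FG. norm (w (fst y) * f (fst y) (snd y)) \<le> vbar"
      using AE_S by eventually_elim (use payoff_box[OF f] bd in \<open>simp only: real_norm_def\<close>)
  qed measurable
  show 2: "integrable FG (\<lambda>y. w (fst y) * mean f (fst y))"
  proof (rule FG.P.integrable_const_bound)
    show "AE y in FG. norm (w (fst y) * mean f (fst y)) \<le> vbar"
      using AE_S by eventually_elim (use mean_box[OF f] bd in \<open>simp only: real_norm_def\<close>)
  qed measurable
  have "(\<integral>y. w (fst y) * f (fst y) (snd y) \<partial>FG) = (\<integral>u. (\<integral>p. w u * f u p \<partial>G) \<partial>F)"
    using FG.integral_fst'[OF 1] by simp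
  also have "\<dots> = (\<integral>u. (\<integral>p. w u * mean f u \<partial>G) \<partial>F)"
    by (simp add: mean_def FG.M2.prob_space)
  also have "\<dots> = (\<integral>y. w (fst y) * mean f (fst y) \<partial>FG)"
    using FG.integral_fst'[OF 2] by simp
  finally show "(\<integral>y. w (fst y) * f (fst y) (snd y) \<partial>FG) = (\<integral>y. w (fst y) * mean f (fst y) \<partial>FG)" .
qed

section \<open>Measurability of the algorithm\<close>

lemma coordinate_measurable [measurable]:
  assumes "t \<in> J"
  shows "(\<lambda>\<omega>. fst (\<omega> t)) \<in> borel_measurable (PiM J (\<lambda>_. FG))" "(\<lambda>\<omega>. snd (\<omega> t)) \<in> borel_measurable (PiM J (\<lambda>_. FG))"
  using assms by measurable

lemma empirical_measurable:
  assumes p: "\<And>\<tau>. \<tau> \<in> {1..m} \<Longrightarrow> (\<lambda>x. p x \<tau>) \<in> borel_measurable M"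
    and [measurable]: "u \<in> borel_measurable M"
  shows "payoff f \<Longrightarrow> (\<lambda>x. \<Sum>\<tau>=1..m. f (u x) (p x \<tau>)) \<in> borel_measurable M"
    and tilde_c_measurable: "(\<lambda>x. tilde_c T (p x) {1..m} (u x)) \<in> borel_measurable M"
    and tilde_r_measurable: "(\<lambda>x. tilde_r T (p x) {1..m} (u x)) \<in> borel_measurable M"
proof -
  show *: "(\<lambda>x. \<Sum>\<tau>=1..m. f (u x) (p x \<tau>)) \<in> borel_measurable M" if "payoff f" for f
    by (intro borel_measurable_sum payoff_measurable[OF that] assms)
  note [measurable] = *[OF payoff_rew] *[OF payoff_cst]
  show "(\<lambda>x. tilde_c T (p x) {1..m} (u x)) \<in> borel_measurable M"
    unfolding tilde_c_def by measurable
  show "(\<lambda>x. tilde_r T (p x) {1..m} (u x)) \<in> borel_measurable M"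
    unfolding tilde_r_def by measurable
qed

lemma ogd_x_measurable:
  assumes p: "\<And>\<tau>. \<tau> \<in> {1..m} \<Longrightarrow> (\<lambda>x. p x \<tau>) \<in> borel_measurable M"
    and l [measurable]: "l \<in> borel_measurable M" and u: "u \<in> borel_measurable M"
  shows "(\<lambda>x. ogd_x T (p x) (l x) {1..m} t (u x)) \<in> borel_measurable M"
proof -
  note [measurable] = tilde_c_measurable[OF p u] tilde_r_measurable[OF p u]
  show ?thesis unfolding ogd_x_def by measurable
qed

text \<open>Stated relative to the state after round \<open>m\<close>, so that it can serve inside
  the induction for \<open>state_measurable\<close>.\<close>

lemma play_measurable_aux:
  assumes m: "m < n" and [measurable]: "(\<lambda>\<omega>. lam (V \<omega>) (P \<omega>) m) \<in> borel_measurable (Om n)"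
    "Measurable.pred (Om n) (\<lambda>\<omega>. act (V \<omega>) (P \<omega>) m)"
  shows "(\<lambda>\<omega>. play (V \<omega>) (P \<omega>) (Suc m)) \<in> borel_measurable (Om n)"
proof -
  have [measurable]: "(\<lambda>\<omega>. ogd_x T (P \<omega>) (lam (V \<omega>) (P \<omega>) m) {1..m} (Suc m) (fst (\<omega> (Suc m)))) \<in> borel_measurable (Om n)"
    using m by (intro ogd_x_measurable coordinate_measurable assms) auto
  show ?thesis unfolding play_def diff_Suc_1 by measurable
qed

lemma state_measurable:
  assumes "m \<le> n"
  shows "(\<lambda>\<omega>. lam (V \<omega>) (P \<omega>) m) \<in> borel_measurable (Om n) \<and>
    (\<lambda>\<omega>. budget (V \<omega>) (P \<omega>) m) \<in> borel_measurable (Om n) \<and>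
    Measurable.pred (Om n) (\<lambda>\<omega>. act (V \<omega>) (P \<omega>) m)"
  using assms
proof (induction m)
  case (Suc m)
  from Suc.prems have "m \<le> n" by simp
  from Suc.IH[OF this] have [measurable]: "(\<lambda>\<omega>. lam (V \<omega>) (P \<omega>) m) \<in> borel_measurable (Om n)"
    "(\<lambda>\<omega>. budget (V \<omega>) (P \<omega>) m) \<in> borel_measurable (Om n)"
    "Measurable.pred (Om n) (\<lambda>\<omega>. act (V \<omega>) (P \<omega>) m)" by blast+
  have [measurable]: "(\<lambda>\<omega>. play (V \<omega>) (P \<omega>) (Suc m)) \<in> borel_measurable (Om n)"
    by (rule play_measurable_aux) (use Suc.prems in \<open>simp, measurable\<close>)
  have [measurable]: "(\<lambda>\<omega>. tilde_c T (P \<omega>) {1..m} (fst (\<omega> (Suc m)))) \<in> borel_measurable (Om n)"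
    "(\<lambda>\<omega>. cst (fst (\<omega> (Suc m))) (snd (\<omega> (Suc m)))) \<in> borel_measurable (Om n)"
    using Suc.prems
    by (intro tilde_c_measurable coordinate_measurable payoff_measurable[OF payoff_cst]; simp)+
  have [measurable]: "(\<lambda>\<omega>. budget (V \<omega>) (P \<omega>) (Suc m)) \<in> borel_measurable (Om n)"
    unfolding budget_Suc by measurable
  show ?case
    unfolding act_Suc lam_Suc by (intro conjI) measurable
qed simp

lemma play_measurable:
  assumes "t \<in> {1..n}"
  shows "(\<lambda>\<omega>. play (V \<omega>) (P \<omega>) t) \<in> borel_measurable (Om n)"
proof -
  obtain m where "t = Suc m" "m < n" using assms by (cases t) auto
  then show ?thesis using play_measurable_aux[of m n] state_measurable[of m n] by simp
qed

definition "rev_gap t \<omega> = rev_term (mean rew) (mean cst) \<pi> Rp Cp (V \<omega>) (P \<omega>) t"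
definition "cost_gap t \<omega> = cost_term (mean cst) (V \<omega>) (P \<omega>) t"

lemma D_measurable:
  assumes t: "t \<in> {1..n}"
  shows "rev_gap t \<in> borel_measurable (Om n)" "cost_gap t \<in> borel_measurable (Om n)"
proof -
  note play = play_measurable[OF t]
  note v = coordinate_measurable(1)[of t "{1..n}"] and p = coordinate_measurable(2)[of t "{1..n}"]
  note mr = measurable_compose[OF v[OF t] mean_measurable[OF payoff_rew]]
  note mc = measurable_compose[OF v[OF t] mean_measurable[OF payoff_cst]]
  note pi = measurable_compose[OF v[OF t] \<pi>_measurable]
  note r = payoff_measurable[OF payoff_rew v[OF t] p[OF t]] and c = payoff_measurable[OF payoff_cst v[OF t] p[OF t]]
  have "t - 1 \<le> n" using t by auto
  note state = state_measurable[OF this, THEN conjunct1] state_measurable[OF this, THEN conjunct2, THEN conjunct2]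
  \<comment> \<open>The shape of \<open>rev_term\<close> with arbitrary measurable ingredients,
    instantiated below.\<close>
  have "(\<lambda>\<omega>. x \<omega> * (m \<omega> - q \<omega>) + (if A \<omega> then (Rp - w \<omega> * m \<omega>) - l \<omega> * (Cp - w \<omega> * k \<omega>) else 0))
      \<in> borel_measurable M"
    if [measurable]: "x \<in> borel_measurable M" "m \<in> borel_measurable M" "q \<in> borel_measurable M"
      "Measurable.pred M A" "w \<in> borel_measurable M" "l \<in> borel_measurable M" "k \<in> borel_measurable M"
    for x m q A w l k and M :: "(nat \<Rightarrow> real \<times> real) measure"
    by measurable
  from this[OF play mr r state(2) pi state(1) mc] show "rev_gap t \<in> borel_measurable (Om n)"
    by (simp only: rev_gap_def[abs_def] rev_term_def)
  show "cost_gap t \<in> borel_measurable (Om n)"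
    unfolding cost_gap_def[abs_def] cost_term_def by (intro borel_measurable_times borel_measurable_diff play c mc)
qed

lemma revenue_measurable:
  "(\<lambda>\<omega>. ogd_revenue True vbar rho T (V \<omega>) (P \<omega>)) \<in> borel_measurable (Om T)"
  unfolding revenue_eq
proof (rule borel_measurable_sum)
  fix t assume t: "t \<in> {1..T}"
  have "(\<lambda>\<omega>. rew (V \<omega> t) (P \<omega> t)) \<in> borel_measurable (Om T)"
    by (rule payoff_measurable[OF payoff_rew coordinate_measurable[OF t]])
  then show "(\<lambda>\<omega>. play (V \<omega>) (P \<omega>) t * rew (V \<omega> t) (P \<omega> t)) \<in> borel_measurable (Om T)"
    by (rule borel_measurable_times[OF play_measurable[OF t]])
qed

section \<open>The martingale differences for a fixed history\<close>

lemma st_upd: "m \<le> n \<Longrightarrow> st (V (x(Suc n := y))) (P (x(Suc n := y))) m = st (V x) (P x) m"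
  by (rule st_cong) auto

lemma D_adapted:
  assumes "t \<le> n"
  shows "rev_gap t (x(Suc n := y)) = rev_gap t x" "cost_gap t (x(Suc n := y)) = cost_gap t x"
proof -
  have *: "st (V (x(Suc n := y))) (P (x(Suc n := y))) (t - 1) = st (V x) (P x) (t - 1)"
    using assms by (intro st_upd) auto
  have "ogd_x T (P (x(Suc n := y))) l {1..t - 1} t u = ogd_x T (P x) l {1..t - 1} t u" for l u
    using assms by (intro ogd_x_cong) auto
  then have "play (V (x(Suc n := y))) (P (x(Suc n := y))) t = play (V x) (P x) t"
    using assms unfolding play_def lam_def act_def * by simp
  then show "rev_gap t (x(Suc n := y)) = rev_gap t x" "cost_gap t (x(Suc n := y)) = cost_gap t x"
    using assms * by (simp_all add: rev_gap_def cost_gap_def rev_term_def cost_term_def lam_def act_def)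
qed

text \<open>The decision of round \<open>n + 1\<close> as a function of the value, for a fixed history \<open>x\<close>.\<close>

definition "bid x n u = (if act (V x) (P x) n then ogd_x T (P x) (lam (V x) (P x) n) {1..n} (Suc n) u else 0)"

lemma play_upd: "play (V (x(Suc n := y))) (P (x(Suc n := y))) (Suc n) = bid x n (fst y)"
proof -
  have *: "st (V (x(Suc n := y))) (P (x(Suc n := y))) n = st (V x) (P x) n"
    by (intro st_upd) auto
  have "ogd_x T (P (x(Suc n := y))) l {1..n} (Suc n) u = ogd_x T (P x) l {1..n} (Suc n) u" for l u
    by (intro ogd_x_cong) auto
  then show ?thesis
    unfolding play_def lam_def act_def diff_Suc_1 * by (simp add: bid_def lam_def act_def)
qed

lemma rev_gap_upd: "rev_gap (Suc n) (x(Suc n := y)) =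
    bid x n (fst y) * mean rew (fst y) - bid x n (fst y) * rew (fst y) (snd y) +
    (if act (V x) (P x) n then (Rp - \<pi> (fst y) * mean rew (fst y))
       - lam (V x) (P x) n * (Cp - \<pi> (fst y) * mean cst (fst y)) else 0)"
  unfolding rev_gap_def rev_term_def play_upd lam_def act_def diff_Suc_1 st_upd[OF order_refl]
  by (simp only: fun_upd_same right_diff_distrib)

lemma cost_gap_upd: "cost_gap (Suc n) (x(Suc n := y)) =
    bid x n (fst y) * cst (fst y) (snd y) - bid x n (fst y) * mean cst (fst y)"
  unfolding cost_gap_def cost_term_def play_upd by (simp only: fun_upd_same right_diff_distrib)

lemma bid_measurable: "bid x n \<in> borel_measurable borel"
proof -
  have "(\<lambda>u. ogd_x T (P x) (lam (V x) (P x) n) {1..n} (Suc n) u) \<in> borel_measurable borel"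
    by (intro ogd_x_measurable) auto
  then show ?thesis
    unfolding bid_def[abs_def] by (cases "act (V x) (P x) n") (simp_all del: One_nat_def)
qed

lemma bid_bounds: "0 \<le> bid x n u \<and> bid x n u \<le> 1"
  by (simp add: bid_def ogd_x_def)

lemma Rp_eq: "Rp = (\<integral>y. \<pi> (fst y) * mean rew (fst y) \<partial>FG)"
  unfolding Rp_def by (rule integral_payoff_eq_mean(3)[OF payoff_rew \<pi>_measurable \<pi>_bounds])

lemma Cp_eq: "Cp = (\<integral>y. \<pi> (fst y) * mean cst (fst y) \<partial>FG)"
  unfolding Cp_def by (rule integral_payoff_eq_mean(3)[OF payoff_cst \<pi>_measurable \<pi>_bounds])

text \<open>Once the history is fixed, the decision is a function of the value, so
  \<open>rew\<close> and its mean have the same weighted integral; the multiplier is a constant, and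
  the policy terms average to \<open>Rp\<close> and \<open>Cp\<close>.\<close>

lemma rev_gap_mean: "(\<integral>y. rev_gap (Suc n) (x(Suc n := y)) \<partial>FG) = 0"
proof -
  note b = integral_payoff_eq_mean[OF payoff_rew bid_measurable bid_bounds, of x n]
  note i1 = integral_payoff_eq_mean(2)[OF payoff_rew \<pi>_measurable \<pi>_bounds]
  note i2 = integral_payoff_eq_mean(2)[OF payoff_cst \<pi>_measurable \<pi>_bounds]
  show ?thesis
  proof (cases "act (V x) (P x) n")
    case True
    have "(\<integral>y. rev_gap (Suc n) (x(Suc n := y)) \<partial>FG)
        = (\<integral>y. bid x n (fst y) * mean rew (fst y) \<partial>FG) - (\<integral>y. bid x n (fst y) * rew (fst y) (snd y) \<partial>FG)
          + ((Rp - (\<integral>y. \<pi> (fst y) * mean rew (fst y) \<partial>FG))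
            - lam (V x) (P x) n * (Cp - (\<integral>y. \<pi> (fst y) * mean cst (fst y) \<partial>FG)))"
      unfolding rev_gap_upd using True b(1,2) i1 i2 by simp
    then show ?thesis unfolding b(3) Rp_eq[symmetric] Cp_eq[symmetric] by simp
  next
    case False
    then show ?thesis unfolding rev_gap_upd using b by simp
  qed
qed

lemma cost_gap_mean: "(\<integral>y. cost_gap (Suc n) (x(Suc n := y)) \<partial>FG) = 0"
  unfolding cost_gap_upd using integral_payoff_eq_mean[OF payoff_cst bid_measurable bid_bounds, of x n] by simp

lemma integral_policy_bounds:
  assumes f: "payoff f"
  shows "0 \<le> (\<integral>y. \<pi> (fst y) * f (fst y) (snd y) \<partial>FG)" "(\<integral>y. \<pi> (fst y) * f (fst y) (snd y) \<partial>FG) \<le> vbar"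
proof -
  have AE: "AE y in FG. 0 \<le> \<pi> (fst y) * f (fst y) (snd y) \<and> \<pi> (fst y) * f (fst y) (snd y) \<le> vbar"
    using AE_S
  proof eventually_elim
    case (elim y)
    then have "0 \<le> f (fst y) (snd y)" "f (fst y) (snd y) \<le> vbar"
      using payoff_box[OF f] by blast+
    then show ?case using \<pi>_bounds[of "fst y"] mult_mono[of "\<pi> (fst y)" 1 "f (fst y) (snd y)" vbar] by auto
  qed
  show "0 \<le> (\<integral>y. \<pi> (fst y) * f (fst y) (snd y) \<partial>FG)"
    by (rule integral_nonneg_AE) (use AE in auto)
  have "(\<integral>y. \<pi> (fst y) * f (fst y) (snd y) \<partial>FG) \<le> (\<integral>y. vbar \<partial>FG)"
    by (rule integral_mono_AE)
       (use AE integral_payoff_eq_mean(1)[OF f \<pi>_measurable \<pi>_bounds] in auto)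
  then show "(\<integral>y. \<pi> (fst y) * f (fst y) (snd y) \<partial>FG) \<le> vbar" by (simp add: FG.P.prob_space)
qed

lemma unit_mult_diff_le:
  fixes b q z :: real
  assumes "0 \<le> b" "b \<le> 1" "0 \<le> q" "q \<le> vbar" "0 \<le> z" "z \<le> vbar"
  shows "\<bar>b * q - b * z\<bar> \<le> vbar" "\<bar>q - b * z\<bar> \<le> vbar"
proof -
  have "0 \<le> b * q" "b * q \<le> q" "0 \<le> b * z" "b * z \<le> z"
    using assms by (simp_all add: mult_left_le_one_le)
  then show "\<bar>b * q - b * z\<bar> \<le> vbar" "\<bar>q - b * z\<bar> \<le> vbar"
    using assms by linarith+
qed

lemma rev_gap_bound:
  assumes x: "\<forall>i\<in>{1..n}. x i \<in> S" and y: "y \<in> S"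
  shows "\<bar>rev_gap (Suc n) (x(Suc n := y))\<bar> \<le> rev_gap_max"
proof -
  have l: "0 \<le> lam (V x) (P x) n" "lam (V x) (P x) n \<le> Lam"
    using x by (auto intro!: lam_nonneg lam_le simp: mem_Times_iff)
  let ?b = "bid x n (fst y)"
  have 1: "\<bar>?b * mean rew (fst y) - ?b * rew (fst y) (snd y)\<bar> \<le> vbar"
    using bid_bounds[of x n "fst y"] mean_box[OF payoff_rew y] payoff_box[OF payoff_rew y]
    by (intro unit_mult_diff_le) auto
  have 2: "\<bar>Rp - \<pi> (fst y) * mean rew (fst y)\<bar> \<le> vbar"
    using \<pi>_bounds[of "fst y"] mean_box[OF payoff_rew y] integral_policy_bounds[OF payoff_rew]
    by (intro unit_mult_diff_le) (auto simp: Rp_def)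
  have 3: "\<bar>Cp - \<pi> (fst y) * mean cst (fst y)\<bar> \<le> vbar"
    using \<pi>_bounds[of "fst y"] mean_box[OF payoff_cst y] integral_policy_bounds[OF payoff_cst]
    by (intro unit_mult_diff_le) (auto simp: Cp_def)
  have 4: "\<bar>lam (V x) (P x) n * (Cp - \<pi> (fst y) * mean cst (fst y))\<bar> \<le> Lam * vbar"
    unfolding abs_mult using l 3 by (intro mult_mono) auto
  have "0 \<le> Lam * vbar" using l vbar by simp
  then show ?thesis
    unfolding rev_gap_upd rev_gap_max_def using 1 2 4 vbar
    by (cases "act (V x) (P x) n") (simp_all add: abs_le_iff algebra_simps)
qed

lemma cost_gap_bound:
  assumes y: "y \<in> S"
  shows "\<bar>cost_gap (Suc n) (x(Suc n := y))\<bar> \<le> vbar"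
  unfolding cost_gap_upd using bid_bounds[of x n "fst y"] mean_box[OF payoff_cst y] payoff_box[OF payoff_cst y]
  by (intro unit_mult_diff_le) auto

section \<open>Accuracy of the empirical estimates\<close>

lemma integral_snd: "payoff f \<Longrightarrow> 0 \<le> u \<Longrightarrow> (\<integral>y. f u (snd y) \<partial>FG) = mean f u"
proof -
  assume f: "payoff f" and u: "0 \<le> u"
  have [measurable]: "(\<lambda>y. f u (snd y)) \<in> borel_measurable FG"
    by (rule payoff_measurable[OF f]) measurable
  have "integrable FG (\<lambda>y. f u (snd y))"
  proof (rule FG.P.integrable_const_bound)
    show "AE y in FG. norm (f u (snd y)) \<le> u"
      using AE_S
    proof eventually_elim
      case (elim y)
      then have "0 \<le> snd y" by (simp add: mem_Times_iff)
      with f u have "0 \<le> f u (snd y)" "f u (snd y) \<le> u" unfolding payoff_def by blast+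
      then show ?case by simp
    qed
  qed measurable
  from FG.integral_fst'[OF this] show ?thesis by (simp add: mean_def)
qed

text \<open>The radius is calibrated for this: \<open>ln 2\<close> cancels the factor of the
  two-sided Hoeffding bound, and \<open>2 * ln T\<close> yields the square of
  \<open>T\<close>.\<close>

lemma two_exp_eps_le:
  assumes "1 \<le> n"
  shows "2 * exp (- 2 * real n * (ocb_eps T {1..n})\<^sup>2) = 1 / (real T)\<^sup>2"
proof -
  have "0 \<le> ln 2 + 2 * ln (real T)" using ln_T_ge_1[OF T3] by (intro add_nonneg_nonneg) auto
  then have "(ocb_eps T {1..n})\<^sup>2 = (ln 2 + 2 * ln T) / (2 * n)"
    unfolding ocb_eps_def by (subst real_sqrt_pow2) auto
  then have "- 2 * real n * (ocb_eps T {1..n})\<^sup>2 = - ln 2 - 2 * ln T"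
    using assms by (simp add: field_simps)
  then have "exp (- 2 * real n * (ocb_eps T {1..n})\<^sup>2) = exp (- ln 2) * exp (- (2 * ln T))"
    by (simp only: exp_add[symmetric]) simp
  also have "\<dots> = (1 / 2) * (1 / (real T)\<^sup>2)"
    using T3 by (simp add: exp_minus exp_double inverse_eq_divide)
  finally show ?thesis by simp
qed

text \<open>Hoeffding's inequality for independent samples in \<open>[0, u]\<close>, where the
  radius scales with \<open>u\<close> and the factor cancels. The index set \<open>J\<close> is left
  general so that the round whose value is fixed can be omitted from it.\<close>

lemma deviation_prob_fixed:
  assumes f: "payoff f" and u: "0 \<le> u" and t: "2 \<le> t" and J: "finite J" "{1..t - 1} \<subseteq> J"
  shows "measure (PiM J (\<lambda>_. FG)) {x \<in> space (PiM J (\<lambda>_. FG)). deviation (P x) f (mean f) t u} \<le> 1 / (real T)\<^sup>2"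
proof -
  let ?M = "PiM J (\<lambda>_. FG)" and ?I = "{1..t - 1}"
  interpret PJ: prob_space ?M by (intro prob_space_PiM prob_FG)
  define X where "X \<tau> x = f u (snd (x \<tau>))" for \<tau> :: nat and x :: "nat \<Rightarrow> real \<times> real"
  have fm [measurable]: "(\<lambda>y. f u (snd y)) \<in> borel_measurable FG"
    by (rule payoff_measurable[OF f]) measurable
  have one: "1 \<in> J" using t J by auto
  have AE_X: "AE x in ?M. X \<tau> x \<in> {0..u}" if "\<tau> \<in> J" for \<tau>
  proof -
    have "AE x in ?M. x \<tau> \<in> S" by (rule AE_PiM_component[OF prob_FG that AE_S])
    then show ?thesis
    proof eventually_elim
      case (elim x)
      then have "0 \<le> snd (x \<tau>)" by (simp add: mem_Times_iff)
      with f u have "0 \<le> f u (snd (x \<tau>))" "f u (snd (x \<tau>)) \<le> u" unfolding payoff_def by blast+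
      then show ?case by (simp add: X_def)
    qed
  qed
  have distr: "distr ?M borel (X \<tau>) = distr FG borel (\<lambda>y. f u (snd y))" if "\<tau> \<in> J" for \<tau>
  proof -
    have "distr ?M borel (X \<tau>) = distr (distr ?M FG (\<lambda>x. x \<tau>)) borel (\<lambda>y. f u (snd y))"
      by (subst distr_distr[OF fm]) (use that in \<open>auto simp: o_def X_def[abs_def]\<close>)
    then show ?thesis by (simp only: distr_PiM_component[OF prob_FG that])
  qed
  have X_meas: "X \<tau> \<in> borel_measurable ?M" if "\<tau> \<in> J" for \<tau>
  proof -
    have "(\<lambda>x. x \<tau>) \<in> ?M \<rightarrow>\<^sub>M FG" using that by simp
    from measurable_compose[OF this fm] show ?thesis by (simp only: X_def[abs_def])
  qed
  have EX: "PJ.expectation (X 1) = mean f u"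
  proof -
    have "PJ.expectation (X 1) = integral\<^sup>L (distr ?M borel (X 1)) (\<lambda>z. z)"
      by (rule integral_distr[symmetric, OF X_meas[OF one]]) simp
    also have "\<dots> = (\<integral>y. f u (snd y) \<partial>FG)"
      unfolding distr[OF one] by (rule integral_distr[OF fm]) simp
    finally show ?thesis by (simp only: integral_snd[OF f u])
  qed
  show ?thesis
  proof (cases "u = 0")
    \<comment> \<open>The interval is degenerate for \<open>u = 0\<close>, but then payoffs and mean
      vanish almost surely and the strict inequality fails.\<close>
    case True
    have "AE x in ?M. \<forall>\<tau>\<in>?I. X \<tau> x \<in> {0..u}"
      by (intro AE_finite_allI AE_X) (use J in auto)
    then have "AE x in ?M. \<not> deviation (P x) f (mean f) t u"
    proof eventually_elim
      case (elim x)
      then have "(\<Sum>\<tau>=1..t - 1. f u (snd (x \<tau>))) = 0"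
        using True by (intro sum.neutral) (auto simp: X_def)
      moreover have "mean f u = 0" using mean_bounds[OF f u] True by simp
      ultimately show ?case using True by (simp add: deviation_def)
    qed
    from emeasure_eq_0_AE[OF this] show ?thesis by (simp add: measure_def)
  next
    case False
    then have u: "0 < u" using u by simp
    interpret H: Hoeffding_ineq_iid ?M ?I X "X 1" 0 u "PJ.expectation (X 1)"
    proof unfold_locales
      have "PJ.indep_vars (\<lambda>_. FG) (\<lambda>\<tau> x. x \<tau>) ?I"
        by (rule indep_vars_PiM_coordinates[OF prob_FG]) (use J t in auto)
      then show "PJ.indep_vars (\<lambda>_. borel) X ?I"
        unfolding X_def[abs_def] by (rule PJ.indep_vars_compose2) (rule fm)
      show "distr ?M borel (X i) = distr ?M borel (X 1)" if "i \<in> ?I" for i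
        using distr[of i] distr[OF one] that J by auto
      show "X 1 \<in> borel_measurable ?M" by (rule X_meas[OF one])
      show "AE x in ?M. X 1 x \<in> {0..u}" by (rule AE_X[OF one])
    qed simp_all
    let ?e = "ocb_eps T ?I"
    have "PJ.prob {x \<in> space ?M. deviation (P x) f (mean f) t u}
        \<le> PJ.prob {x \<in> space ?M. \<bar>(\<Sum>\<tau>\<in>?I. X \<tau> x) / real (card ?I) - PJ.expectation (X 1)\<bar> \<ge> ?e * u}"
    proof (rule PJ.finite_measure_mono)
      have "(\<lambda>x. \<Sum>\<tau>\<in>?I. X \<tau> x) \<in> borel_measurable ?M"
        by (intro borel_measurable_sum X_meas) (use J in auto)
      then show "{x \<in> space ?M. \<bar>(\<Sum>\<tau>\<in>?I. X \<tau> x) / real (card ?I) - PJ.expectation (X 1)\<bar> \<ge> ?e * u} \<in> PJ.events"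
        by measurable
    qed (auto simp: deviation_def EX[unfolded One_nat_def] X_def)
    also have "\<dots> \<le> 2 * exp (- 2 * real (card ?I) * (?e * u)\<^sup>2 / (u - 0)\<^sup>2)"
      by (rule H.Hoeffding_ineq_abs_ge') (use t u ocb_eps_nonneg in auto)
    also have "- 2 * real (card ?I) * (?e * u)\<^sup>2 / (u - 0)\<^sup>2 = - 2 * real (t - 1) * ?e\<^sup>2"
      using u by (simp add: power_mult_distrib)
    also have "2 * exp \<dots> = 1 / (real T)\<^sup>2"
      by (rule two_exp_eps_le) (use t in auto)
    finally show ?thesis .
  qed
qed

definition "deviation_event f t = {\<omega> \<in> space (Om T). deviation (P \<omega>) f (mean f) t (V \<omega> t)}"

lemma deviation_event_measurable:
  assumes f: "payoff f" and t: "t \<in> {2..T}"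
  shows "deviation_event f t \<in> sets (Om T)"
proof -
  have t1: "t \<in> {1..T}" using t by auto
  have p: "(\<lambda>\<omega>. P \<omega> \<tau>) \<in> borel_measurable (Om T)" if "\<tau> \<in> {1..t - 1}" for \<tau>
    by (rule coordinate_measurable(2)) (use that t in auto)
  note v = coordinate_measurable(1)[OF t1]
  have "{x \<in> space M. \<bar>s x / a - m x\<bar> > e * w x} \<in> sets M"
    if [measurable]: "s \<in> borel_measurable M" "m \<in> borel_measurable M" "w \<in> borel_measurable M"
    for s m w and a e :: real and M :: "(nat \<Rightarrow> real \<times> real) measure"
    by measurable
  from this[OF empirical_measurable(1)[OF p v f] measurable_compose[OF v mean_measurable[OF f]] v]
  show ?thesis by (simp only: deviation_event_def deviation_def)
qed

text \<open>The value of round \<open>t\<close> is random but independent of the bids of earlier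
  rounds. Integrating coordinate \<open>t\<close> last reduces the claim to a fixed value.\<close>

lemma deviation_event_prob:
  assumes f: "payoff f" and t: "t \<in> {2..T}"
  shows "measure (Om T) (deviation_event f t) \<le> 1 / (real T)\<^sup>2"
proof -
  interpret PT: prob_space "Om T" by (intro prob_space_PiM prob_FG)
  interpret ps: product_sigma_finite "\<lambda>_::nat. FG" by standard
  let ?J = "{1..T} - {t}"
  let ?PJ = "PiM ?J (\<lambda>_. FG)"
  interpret PJ: prob_space ?PJ by (intro prob_space_PiM prob_FG)
  have ins: "{1..T} = insert t ?J" using t by auto
  have m: "(indicator (deviation_event f t) :: _ \<Rightarrow> ennreal) \<in> borel_measurable (PiM (insert t ?J) (\<lambda>_. FG))"
    unfolding ins[symmetric] using deviation_event_measurable[OF f t] by measurable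
  have "emeasure (Om T) (deviation_event f t) = (\<integral>\<^sup>+\<omega>. indicator (deviation_event f t) \<omega> \<partial>PiM (insert t ?J) (\<lambda>_. FG))"
    unfolding ins[symmetric] using deviation_event_measurable[OF f t] by simp
  also have "\<dots> = (\<integral>\<^sup>+y. (\<integral>\<^sup>+x. indicator (deviation_event f t) (x(t := y)) \<partial>?PJ) \<partial>FG)"
    by (rule ps.product_nn_integral_insert_rev[OF _ _ m]) auto
  also have "\<dots> \<le> (\<integral>\<^sup>+y. ennreal (1 / (real T)\<^sup>2) \<partial>FG)"
  proof (rule nn_integral_mono_AE)
    show "AE y in FG. (\<integral>\<^sup>+x. indicator (deviation_event f t) (x(t := y)) \<partial>?PJ) \<le> ennreal (1 / (real T)\<^sup>2)"
      using AE_S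
    proof eventually_elim
      case (elim y)
      let ?A = "{x \<in> space ?PJ. deviation (P x) f (mean f) t (fst y)}"
      have "(\<lambda>x. x(t := y)) \<in> ?PJ \<rightarrow>\<^sub>M PiM (insert t ?J) (\<lambda>_. FG)"
        by (rule measurable_fun_upd[where J="?J"]) auto
      then have upd: "(\<lambda>x. x(t := y)) \<in> ?PJ \<rightarrow>\<^sub>M Om T" unfolding ins[symmetric] .
      have eq: "x(t := y) \<in> deviation_event f t \<longleftrightarrow> x \<in> ?A" if "x \<in> space ?PJ" for x
      proof -
        have "(\<Sum>\<tau>=1..t - 1. f (fst y) (P (x(t := y)) \<tau>)) = (\<Sum>\<tau>=1..t - 1. f (fst y) (P x \<tau>))"
          by (intro sum.cong) auto
        then show ?thesis
          using that measurable_space[OF upd that] by (simp add: deviation_event_def deviation_def)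
      qed
      have "?A = (\<lambda>x. x(t := y)) -` deviation_event f t \<inter> space ?PJ" using eq by blast
      then have A: "?A \<in> sets ?PJ" using measurable_sets[OF upd deviation_event_measurable[OF f t]] by simp
      have "(\<integral>\<^sup>+x. indicator (deviation_event f t) (x(t := y)) \<partial>?PJ) = (\<integral>\<^sup>+x. indicator ?A x \<partial>?PJ)"
        by (intro nn_integral_cong) (use eq in \<open>simp add: indicator_def\<close>)
      also have "\<dots> = ennreal (PJ.prob ?A)" by (simp only: nn_integral_indicator[OF A] PJ.emeasure_eq_measure)
      also have "\<dots> \<le> ennreal (1 / (real T)\<^sup>2)"
        by (intro ennreal_leI deviation_prob_fixed f) (use elim t in \<open>auto simp: mem_Times_iff\<close>)
      finally show ?case .
    qed
  qed
  also have "\<dots> = ennreal (1 / (real T)\<^sup>2)"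
    using FG.P.emeasure_space_1 by simp
  finally show ?thesis by (simp add: PT.emeasure_eq_measure del: One_nat_def)
qed

section \<open>The regret bound with high probability\<close>

lemma AE_box: "AE \<omega> in Om T. \<forall>t\<in>{1..T}. \<omega> t \<in> S"
  by (rule AE_finite_allI) (auto intro!: AE_PiM_component[OF prob_FG _ AE_S])

text \<open>The level makes the Azuma exponent equal to \<open>- ln T\<close>.\<close>

lemma azuma_at_level:
  assumes meas: "\<And>t n. t \<in> {1..n} \<Longrightarrow> n \<le> T \<Longrightarrow> D t \<in> borel_measurable (Om n)"
    and adapted: "\<And>t n x y. t \<le> n \<Longrightarrow> D t (x(Suc n := y)) = D t x"
    and bound: "\<And>n x y. n < T \<Longrightarrow> (\<forall>i\<in>{1..n}. x i \<in> S) \<Longrightarrow> y \<in> S \<Longrightarrow> \<bar>D (Suc n) (x(Suc n := y))\<bar> \<le> K"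
    and mean: "\<And>n x. (\<integral>y. D (Suc n) (x(Suc n := y)) \<partial>FG) = 0"
    and K: "K > 0"
  shows "measure (Om T) {\<omega> \<in> space (Om T). (\<Sum>t=1..T. D t \<omega>) \<ge> K * (sqrt 2 * sqrt (T * ln T))} \<le> 1 / T"
proof -
  let ?z = "K * (sqrt 2 * sqrt (T * ln T))"
  have L: "0 < T * ln T" using ln_T_ge_1[OF T3] T3 by simp
  have "measure (Om T) {\<omega> \<in> space (Om T). (\<Sum>t=1..T. D t \<omega>) \<ge> ?z} \<le> exp (- ?z\<^sup>2 / (2 * real T * K\<^sup>2))"
    by (rule azuma[OF prob_FG meas adapted AE_S bound mean K]) (use T3 L K in auto)
  also have "?z\<^sup>2 = 2 * real T * K\<^sup>2 * ln T"
    using L by (simp add: power_mult_distrib)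
  also have "- (2 * real T * K\<^sup>2 * ln T) / (2 * real T * K\<^sup>2) = - ln T"
    using K T3 by simp
  also have "exp (- ln T) = 1 / T"
    using T3 by (simp add: exp_minus inverse_eq_divide)
  finally show ?thesis .
qed

lemma regret_high_probability:
  assumes "Cp \<le> rho"
  shows "measure (Om T) {\<omega> \<in> space (Om T).
      T * Rp - ogd_revenue True vbar rho T (V \<omega>) (P \<omega>) \<le> regret_const * sqrt (T * ln T)} \<ge> 1 - 4 / T"
    (is "measure _ ?G \<ge> _")
proof -
  interpret PT: prob_space "Om T" by (intro prob_space_PiM prob_FG)
  let ?Q = "sqrt (T * ln T)"
  let ?A = "\<lambda>D K. {\<omega> \<in> space (Om T). (\<Sum>t=1..T. D t \<omega>) \<ge> K * (sqrt 2 * ?Q)}"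
  have Lam: "0 < Lam" using vbar rho by (simp add: Lam_def add_pos_pos)
  then have rev_gap_max: "0 < rev_gap_max" using vbar by (simp add: rev_gap_max_def)
  have Q: "1 \<le> ?Q"
    by (rule order.trans[OF _ sqrt_T_le[OF T3]]) (use T3 in simp)
  have G: "?G \<in> PT.events" using revenue_measurable by measurable
  have A1: "?A rev_gap rev_gap_max \<in> PT.events"
  proof -
    have "(\<lambda>\<omega>. \<Sum>t=1..T. rev_gap t \<omega>) \<in> borel_measurable (Om T)"
      by (intro borel_measurable_sum D_measurable)
    then show ?thesis by measurable
  qed
  have A2: "?A cost_gap vbar \<in> PT.events"
  proof -
    have "(\<lambda>\<omega>. \<Sum>t=1..T. cost_gap t \<omega>) \<in> borel_measurable (Om T)"
      by (intro borel_measurable_sum D_measurable)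
    then show ?thesis by measurable
  qed
  \<comment> \<open>The failure budget: two deviation events of probability at most
    \<open>1 / T^2\<close> in each of \<open>T - 1\<close> rounds, and \<open>1 / T\<close> for each
    of the two martingales, together at most \<open>4 / T\<close>.\<close>
  let ?Dv = "\<Union>t\<in>{2..T}. deviation_event rew t \<union> deviation_event cst t"
  have Dv_t: "deviation_event rew t \<union> deviation_event cst t \<in> PT.events" if "t \<in> {2..T}" for t
    using deviation_event_measurable[OF payoff_rew that] deviation_event_measurable[OF payoff_cst that] by auto
  then have Dv: "?Dv \<in> PT.events" by auto
  have good: "\<omega> \<in> ?G"
    if \<omega>: "\<omega> \<in> space (Om T)" "\<forall>t\<in>{1..T}. \<omega> t \<in> S" "\<omega> \<notin> ?Dv \<union> ?A rev_gap rev_gap_max \<union> ?A cost_gap vbar" for \<omega>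
  proof -
    have "T * Rp - ogd_revenue True vbar rho T (V \<omega>) (P \<omega>)
        \<le> rev_gap_max * (sqrt 2 * ?Q) + ogd_err + 2 * vbar * eps_sum
          + vbar / rho * (2 * vbar + vbar * (sqrt 2 * ?Q) + 3 * vbar * eps_sum)"
    proof (rule regret_le[where r="mean rew" and c="mean cst" and \<pi>=\<pi> and Cp=Cp])
      show "0 \<le> V \<omega> t \<and> V \<omega> t \<le> vbar" "0 \<le> P \<omega> t \<and> P \<omega> t \<le> vbar" if "t \<in> {1..T}" for t
        using \<omega>(2) that by (auto simp: mem_Times_iff)
      show "0 \<le> mean rew u" if "0 \<le> u" for u using mean_bounds[OF payoff_rew that] by simp
      show "mean cst u \<le> vbar" if "0 \<le> u" "u \<le> vbar" for u using mean_bounds[OF payoff_cst that(1)] that by simp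
      show "\<not> deviation (P \<omega>) rew (mean rew) t (V \<omega> t) \<and> \<not> deviation (P \<omega>) cst (mean cst) t (V \<omega> t)"
        if "t \<in> {2..T}" for t using \<omega>(1,3) that by (auto simp: deviation_event_def)
      show "0 \<le> \<pi> u \<and> \<pi> u \<le> 1" for u by (rule \<pi>_bounds)
      show "Rp \<le> vbar" unfolding Rp_def by (rule integral_policy_bounds[OF payoff_rew])
      show "(\<Sum>t=1..T. rev_term (mean rew) (mean cst) \<pi> Rp Cp (V \<omega>) (P \<omega>) t) \<le> rev_gap_max * (sqrt 2 * ?Q)"
        using \<omega>(1,3) by (simp add: rev_gap_def)
      show "(\<Sum>t=1..T. cost_term (mean cst) (V \<omega>) (P \<omega>) t) \<le> vbar * (sqrt 2 * ?Q)"
        using \<omega>(1,3) by (simp add: cost_gap_def)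
      show "0 \<le> vbar * (sqrt 2 * ?Q)" using vbar Q by simp
    qed (use T3 assms in auto)
    also have "\<dots> \<le> rev_gap_max * (sqrt 2 * ?Q) + vbar * (Lam\<^sup>2 / 2 + 20) * ?Q + 2 * vbar * (3 * ?Q)
          + vbar / rho * (2 * vbar * ?Q + vbar * (sqrt 2 * ?Q) + 3 * vbar * (3 * ?Q))"
    proof -
      \<comment> \<open>The additive constant is absorbed into \<open>?Q\<close>, which is at least
        1.\<close>
      have "2 * vbar * 1 \<le> 2 * vbar * ?Q" using vbar Q by (intro mult_left_mono) auto
      then show ?thesis
        using eps_sum_le[OF T3] ogd_err_le[OF T3] vbar rho
        by (intro add_mono mult_left_mono order_refl) auto
    qed
    also have "\<dots> = regret_const * ?Q"
      by (simp add: regret_const_def algebra_simps)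
    finally show ?thesis using \<omega>(1) by simp
  qed
  have "PT.prob (space (Om T) - ?G) \<le> PT.prob (?Dv \<union> ?A rev_gap rev_gap_max \<union> ?A cost_gap vbar)"
  proof (rule PT.finite_measure_mono_AE)
    \<comment> \<open>The inclusion is only almost sure, because the pathwise bound needs all values
      and bids in \<open>[0, vbar]\<close>.\<close>
    show "AE \<omega> in Om T. \<omega> \<in> space (Om T) - ?G \<longrightarrow> \<omega> \<in> ?Dv \<union> ?A rev_gap rev_gap_max \<union> ?A cost_gap vbar"
      using AE_box by eventually_elim (use good in blast)
    show "?Dv \<union> ?A rev_gap rev_gap_max \<union> ?A cost_gap vbar \<in> PT.events" using Dv A1 A2 by (intro sets.Un)
  qed
  also have "\<dots> \<le> PT.prob ?Dv + PT.prob (?A rev_gap rev_gap_max) + PT.prob (?A cost_gap vbar)"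
    using measure_Un_le[OF sets.Un[OF Dv A1] A2] measure_Un_le[OF Dv A1] by linarith
  also have "\<dots> \<le> 2 / T + 1 / T + 1 / T"
  proof (intro add_mono)
    have "PT.prob ?Dv \<le> (\<Sum>t\<in>{2..T}. PT.prob (deviation_event rew t \<union> deviation_event cst t))"
      by (rule measure_UNION_le) (use Dv_t in auto)
    also have "\<dots> \<le> (\<Sum>t\<in>{2..T}. 2 / (real T)\<^sup>2)"
    proof (rule sum_mono)
      fix t assume t: "t \<in> {2..T}"
      show "PT.prob (deviation_event rew t \<union> deviation_event cst t) \<le> 2 / (real T)\<^sup>2"
        using measure_Un_le[OF deviation_event_measurable[OF payoff_rew t] deviation_event_measurable[OF payoff_cst t]]
          deviation_event_prob[OF payoff_rew t] deviation_event_prob[OF payoff_cst t] by simp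
    qed
    also have "\<dots> = (T - 1) * (2 / (real T)\<^sup>2)" by simp
    also have "\<dots> \<le> T * (2 / (real T)\<^sup>2)" by (intro mult_right_mono) auto
    also have "\<dots> = 2 / T" using T3 by (simp add: power2_eq_square)
    finally show "PT.prob ?Dv \<le> 2 / T" .
    show "PT.prob (?A rev_gap rev_gap_max) \<le> 1 / T"
      by (rule azuma_at_level[OF D_measurable(1) D_adapted(1) rev_gap_bound rev_gap_mean rev_gap_max])
    show "PT.prob (?A cost_gap vbar) \<le> 1 / T"
      by (rule azuma_at_level[OF D_measurable(2) D_adapted(2) cost_gap_bound cost_gap_mean vbar])
  qed
  finally have "PT.prob (space (Om T) - ?G) \<le> 4 / T" by simp
  then show ?thesis using PT.prob_compl[OF G] by simp
qed

end

section \<open>From a near-optimal policy to the fluid benchmark\<close>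

theorem theorem4:
  fixes vbar rho :: real
  assumes "0 < vbar" and "0 < rho" and "rho \<le> vbar"
  shows "\<exists>C::real. \<forall>(F::real measure) (G::real measure) (T::nat).
     prob_space F \<and> prob_space G \<and> sets F = sets borel \<and> sets G = sets borel \<and>
     measure F {0..vbar} = 1 \<and> measure G {0..vbar} = 1 \<and> T \<ge> 1 \<longrightarrow>
     measure (PiM {1..T} (\<lambda>_. F \<Otimes>\<^sub>M G))
       {\<omega> \<in> space (PiM {1..T} (\<lambda>_. F \<Otimes>\<^sub>M G)).
          fluid_opt F G rho T
            - ogd_revenue True vbar rho T (\<lambda>t. fst (\<omega> t)) (\<lambda>t. snd (\<omega> t))
          \<le> C * sqrt (real T * ln (real T))}
     \<ge> 1 - 4 / real T"
proof (intro exI allI impI)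
  fix F G :: "real measure" and T :: nat
  assume H: "prob_space F \<and> prob_space G \<and> sets F = sets borel \<and> sets G = sets borel \<and>
     measure F {0..vbar} = 1 \<and> measure G {0..vbar} = 1 \<and> T \<ge> 1"
  \<comment> \<open>The constant depends on \<open>vbar\<close> and \<open>rho\<close> only. The
    added 1 pays for using a policy that is optimal up to \<open>1 / T\<close> per round, hence up
    to 1 over \<open>T\<close> rounds.\<close>
  let ?C = "ogd_full.regret_const vbar rho + 1"
  let ?Om = "PiM {1..T} (\<lambda>_. F \<Otimes>\<^sub>M G)"
  let ?R = "\<lambda>\<omega>. ogd_revenue True vbar rho T (\<lambda>t. fst (\<omega> t)) (\<lambda>t. snd (\<omega> t))"
  let ?E = "{\<omega> \<in> space ?Om. fluid_opt F G rho T - ?R \<omega> \<le> ?C * sqrt (real T * ln (real T))}"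
  show "measure ?Om ?E \<ge> 1 - 4 / real T"
  proof (cases "3 \<le> T")
    case False
    \<comment> \<open>For such small \<open>T\<close> the required probability is not
      positive.\<close>
    then have "1 - 4 / real T \<le> 0" using H by (simp add: field_simps)
    then show ?thesis using measure_nonneg[of ?Om ?E] by linarith
  next
    case T: True
    define \<V> where "\<V> = {(\<integral>vp. \<pi> (fst vp) * rew (fst vp) (snd vp) \<partial>(F \<Otimes>\<^sub>M G)) | \<pi>.
        \<pi> \<in> borel_measurable borel \<and> (\<forall>x. 0 \<le> \<pi> x \<and> \<pi> x \<le> 1) \<and>
        (\<integral>vp. \<pi> (fst vp) * cst (fst vp) (snd vp) \<partial>(F \<Otimes>\<^sub>M G)) \<le> rho}"
    \<comment> \<open>The policy that never buys is feasible, so the supremum is over a nonempty set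
      and can be approximated from within.\<close>
    have "0 \<in> \<V>"
      unfolding \<V>_def using \<open>0 < rho\<close> by (auto intro!: exI[of _ "\<lambda>_. 0"])
    then have "\<V> \<noteq> {}" by blast
    moreover have "Sup \<V> - 1 / T < Sup \<V>" using T by simp
    ultimately obtain a where a: "a \<in> \<V>" "Sup \<V> - 1 / T < a" by (meson less_cSupD)
    then obtain \<pi> where \<pi>: "a = (\<integral>vp. \<pi> (fst vp) * rew (fst vp) (snd vp) \<partial>(F \<Otimes>\<^sub>M G))"
      "\<pi> \<in> borel_measurable borel" "\<And>x. 0 \<le> \<pi> x \<and> \<pi> x \<le> 1"
      "(\<integral>vp. \<pi> (fst vp) * cst (fst vp) (snd vp) \<partial>(F \<Otimes>\<^sub>M G)) \<le> rho"
      unfolding \<V>_def by blast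
    interpret ogd_stoch vbar rho T F G \<pi>
      using H by (intro ogd_stoch.intro ogd_full.intro ogd_stoch_axioms.intro) (simp_all add: assms T \<pi>(2,3))
    interpret PT: prob_space ?Om by (intro prob_space_PiM prob_FG)
    have "T * Sup \<V> \<le> T * (a + 1 / T)" using a(2) by (intro mult_left_mono) auto
    then have opt: "fluid_opt F G rho T \<le> T * Rp + 1"
      using T \<pi>(1) by (simp add: fluid_opt_def \<V>_def Rp_def distrib_left)
    have Q: "1 \<le> sqrt (T * ln T)"
      by (rule order.trans[OF _ sqrt_T_le[OF T]]) (use T in simp)
    have "1 - 4 / T \<le> measure ?Om {\<omega> \<in> space ?Om. T * Rp - ?R \<omega> \<le> regret_const * sqrt (T * ln T)}"
      by (rule regret_high_probability) (use \<pi>(4) in \<open>simp add: Cp_def\<close>)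
    also have "\<dots> \<le> measure ?Om ?E"
    proof (rule PT.finite_measure_mono)
      have "(\<lambda>\<omega>. fluid_opt F G rho T - ?R \<omega>) \<in> borel_measurable ?Om"
        by (intro borel_measurable_diff borel_measurable_const revenue_measurable)
      then show "?E \<in> PT.events" by measurable
      show "{\<omega> \<in> space ?Om. T * Rp - ?R \<omega> \<le> regret_const * sqrt (T * ln T)} \<subseteq> ?E"
        using opt Q unfolding distrib_right mult_1 by (intro Collect_mono) linarith
    qed
    finally show ?thesis .
  qed
qed

end
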